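(* Under the sequence of Gibbs measures $\mu_{N,\alpha,\beta}$, the matrix-valued random variables $M_N=(m_{k,c})_{1\le k\le s,\,1\le c\le q}$ satisfy, as $N\to\infty$, a large deviation principle on $\mathbb{R}^{s\times q}$ with speed $N$ and rate function $J=J_{\alpha,\beta}$ given as follows. Let $\mathcal{P}$ be the set of $s\times q$ matrices $\nu=(\nu_{k,c})$ each of whose rows $\nu_k=(\nu_{k,1},\dots,\nu_{k,q})$ is a probability vector on $\{1,\dots,q\}$. For $\nu\in\mathcal{P}$, $$J(\nu)=-\Big[\tfrac12\langle\Gamma\nu,\Gamma\nu\rangle_A-I(\nu)\Big]+\sup_{\mu\in\mathcal{P}}\Big[\tfrac12\langle\Gamma\mu,\Gamma\mu\rangle_A-I(\mu)\Big]$$ $$=-\Big[\frac{\beta}{2}\sum_{c=1}^q\sum_{k=1}^s\gamma_k^2\nu_{k,c}^2+\frac{\alpha}{2}\sum_{c=1}^q\sum_{k\ne k'}\gamma_k\gamma_{k'}\nu_{k,c}\nu_{k',c}-I(\nu)\Big]+\sup_{\mu\in\mathcal{P}}\Big[\frac{\beta}{2}\sum_{c=1}^q\sum_{k=1}^s\gamma_k^2\mu_{k,c}^2+\frac{\alpha}{2}\sum_{c=1}^q\sum_{k\neq k'}\gamma_k\gamma_{k'}\mu_{k,c}\mu_{k',c}-I(\mu)\Big],$$ and $J(\nu)=\infty$ for $\nu\notin\mathcal{P}$.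
   Context: Block spin Potts model: for each $N$, $S=\{1,\dots,N\}$ is partitioned into $s$ blocks $S_1,\dots,S_s$ (depending on $N$; $s$ is fixed) such that the limits $\gamma_k=\lim_{N\to\infty}|S_k|/N\in(0,1)$ exist, with $\sum_{k=1}^s\gamma_k=1$. Fix an integer $q\ge3$ and reals $0<\alpha<\beta$. For $\omega\in\{1,\dots,q\}^S$, $$H_N(\omega)=-\frac{\beta}{2N}\sum_{i\sim j}\mathbf{1}_{\omega_i=\omega_j}-\frac{\alpha}{2N}\sum_{i\not\sim j}\mathbf{1}_{\omega_i=\omega_j},$$ where the sums run over ordered pairs $(i,j)\in S^2$, and $i\sim j$ means that $i,j$ lie in the same block (the case $i=j$ is included). The Gibbs measure is $\mu_{N,\alpha,\beta}(\omega)=e^{-H_N(\omega)}/Z_N$ with $Z_N=\sum_{\omega'}e^{-H_N(\omega')}$. Order parameter: $m_{k,c}(\omega)=\frac1{|S_k|}\sum_{i\in S_k}\mathbf{1}_{\omega_i=c}$ for $1\le k\le s$, $1\le c\le q$, and $M_N=(m_{k,c})\in\mathbb{R}^{s\times q}$. Notation: $A\in\mathbb{R}^{s\times s}$ is the symmetric matrix with entries $\beta$ on the diagonal and $\alpha$ off the diagonal; $\langle B,B\rangle_A=\operatorname{tr}(B^tAB)$ for $B\in\mathbb{R}^{s\times q}$; $\Gamma$ is the $s\times s$ diagonal matrix with $\Gamma_{kk}=\gamma_k$; sums over $k\ne k'$ run over ordered pairs. For $\nu\in\mathcal{P}$, $I(\nu)=\log q+\sum_{k=1}^s\gamma_k\sum_{c=1}^q\nu_{k,c}\log\nu_{k,c}$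 with $0\log0=0$ (equivalently, $I(\nu)=\sum_k\gamma_kH(\nu_k|\rho)$, where $H(\cdot|\rho)$ is relative entropy with respect to the uniform measure $\rho$ on $\{1,\dots,q\}$). Large deviation principle: random variables $X_N$ in a Polish space $\mathcal{X}$ satisfy, under probability measures $\mu_N$, an LDP with speed $a_N$ and rate function $I$ (lower semicontinuous, with compact level sets $\{I\le L\}$) if for all Borel sets $B$: $-\inf_{\mathrm{int}(B)}I\le\liminf_N\frac1{a_N}\log\mu_N(X_N\in B)\le\limsup_N\frac1{a_N}\log\mu_N(X_N\in B)\le-\inf_{\mathrm{cl}(B)}I$. *)

theory Defs
  imports "HOL-Probability.Probability"
begin

section \<open>Large deviation principles\<close>

text \<open>The logarithm of a probability, with \<open>log 0 = -\<infinity>\<close>; note that \<open>ln 0 = 0\<close> over the reals.\<close>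

definition eln :: "real \<Rightarrow> ereal" where
  "eln p = (if p = 0 then -\<infinity> else ereal (ln p))"

text \<open>Rate functions with compact level sets (often called good rate functions).\<close>

definition rate_function :: "('x::topological_space \<Rightarrow> ereal) \<Rightarrow> bool" where
  "rate_function I \<longleftrightarrow>
     (\<forall>x. 0 \<le> I x) \<and>
     (\<forall>a. open {x. a < I x}) \<and>
     (\<forall>L::real. compact {x. I x \<le> ereal L})"

definition LDP ::
  "(nat \<Rightarrow> 'w measure) \<Rightarrow> (nat \<Rightarrow> 'w \<Rightarrow> 'x::polish_space) \<Rightarrow> (nat \<Rightarrow> real) \<Rightarrow> ('x \<Rightarrow> ereal) \<Rightarrow> bool" where
  "LDP P X a I \<longleftrightarrow>
     (\<forall>n. prob_space (P n) \<and> X n \<in> borel_measurable (P n)) \<and>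
     rate_function I \<and>
     (\<forall>B \<in> sets borel.
        let r = (\<lambda>n. eln (measure (P n) {w \<in> space (P n). X n w \<in> B}) / ereal (a n)) in
          - (INF x\<in>interior B. I x) \<le> liminf r \<and>
          liminf r \<le> limsup r \<and>
          limsup r \<le> - (INF x\<in>closure B. I x))"

section \<open>The block spin Potts model\<close>

text \<open>
  The types \<open>'s\<close> and \<open>'q\<close> index the blocks and the colours, so that their cardinalities are the
  number of blocks and the number of colours. A family of blocks \<open>S\<close> gives the \<open>k\<close>-th block
  \<open>S N k\<close> of the vertex set \<open>{1..N}\<close>. The limiting proportions in the second definition are
  positive, so blocks can be empty only for finitely many \<open>N\<close>.
\<close>

definition block_partition :: "(nat \<Rightarrow> 's::finite \<Rightarrow> nat set) \<Rightarrow> bool" where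
  "block_partition S \<longleftrightarrow> (\<forall>N. (\<Union>k. S N k) = {1..N} \<and> disjoint_family (S N))"

definition limiting_proportions :: "(nat \<Rightarrow> 's::finite \<Rightarrow> nat set) \<Rightarrow> ('s \<Rightarrow> real) \<Rightarrow> bool" where
  "limiting_proportions S \<gamma> \<longleftrightarrow>
     (\<forall>k. (\<lambda>N. real (card (S N k)) / real N) \<longlonglongrightarrow> \<gamma> k) \<and>
     (\<forall>k. 0 < \<gamma> k \<and> \<gamma> k < 1) \<and>
     (\<Sum>k\<in>UNIV. \<gamma> k) = 1"

definition configs :: "nat \<Rightarrow> (nat \<Rightarrow> 'q::finite) set" where
  "configs N = {1..N} \<rightarrow>\<^sub>E UNIV"

definition same_block :: "(nat \<Rightarrow> 's::finite \<Rightarrow> nat set) \<Rightarrow> nat \<Rightarrow> nat \<Rightarrow> nat \<Rightarrow> bool" where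
  "same_block S N i j \<longleftrightarrow> (\<exists>k. i \<in> S N k \<and> j \<in> S N k)"

definition hamiltonian ::
  "(nat \<Rightarrow> 's::finite \<Rightarrow> nat set) \<Rightarrow> real \<Rightarrow> real \<Rightarrow> nat \<Rightarrow> (nat \<Rightarrow> 'q::finite) \<Rightarrow> real" where
  "hamiltonian S \<alpha> \<beta> N \<omega> =
     - \<beta> / (2 * real N) *
         (\<Sum>(i, j) \<in> {(i, j) \<in> {1..N} \<times> {1..N}. same_block S N i j}. of_bool (\<omega> i = \<omega> j))
     - \<alpha> / (2 * real N) *
         (\<Sum>(i, j) \<in> {(i, j) \<in> {1..N} \<times> {1..N}. \<not> same_block S N i j}. of_bool (\<omega> i = \<omega> j))"

definition gibbs_measure ::
  "(nat \<Rightarrow> 's::finite \<Rightarrow> nat set) \<Rightarrow> real \<Rightarrow> real \<Rightarrow> nat \<Rightarrow> (nat \<Rightarrow> 'q::finite) measure" where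
  "gibbs_measure S \<alpha> \<beta> N =
     point_measure (configs N)
       (\<lambda>\<omega>. ennreal (exp (- hamiltonian S \<alpha> \<beta> N \<omega>) /
                     (\<Sum>\<omega>'\<in>configs N. exp (- hamiltonian S \<alpha> \<beta> N (\<omega>' :: nat \<Rightarrow> 'q)))))"

text \<open>Matrices with rows indexed by \<open>'s\<close> and columns by \<open>'q\<close> have type \<open>real^'q^'s\<close>.\<close>

definition order_parameter ::
  "(nat \<Rightarrow> 's::finite \<Rightarrow> nat set) \<Rightarrow> nat \<Rightarrow> (nat \<Rightarrow> 'q::finite) \<Rightarrow> real^'q^'s" where
  "order_parameter S N \<omega> =
     (\<chi> k c. 1 / real (card (S N k)) * (\<Sum>i\<in>S N k. of_bool (\<omega> i = c)))"

section \<open>The rate function\<close>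

definition interaction_matrix :: "real \<Rightarrow> real \<Rightarrow> real^'s::finite^'s" where
  "interaction_matrix \<alpha> \<beta> = (\<chi> k k'. if k = k' then \<beta> else \<alpha>)"

definition diag_matrix :: "('s::finite \<Rightarrow> real) \<Rightarrow> real^'s^'s" where
  "diag_matrix \<gamma> = (\<chi> k k'. if k = k' then \<gamma> k else 0)"

definition form_wrt :: "real^'s^'s \<Rightarrow> real^'q^'s \<Rightarrow> real^'q^'s::finite \<Rightarrow> real" where
  "form_wrt A B C = trace (transpose B ** A ** C)"

definition prob_rows :: "(real^'q^'s) set" where
  "prob_rows = {\<nu>. \<forall>k. (\<forall>c. 0 \<le> \<nu> $ k $ c) \<and> (\<Sum>c\<in>UNIV. \<nu> $ k $ c) = 1}"

text \<open>The convention \<open>0 log 0 = 0\<close> holds by multiplication with zero.\<close>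

definition entropy_rate :: "('s::finite \<Rightarrow> real) \<Rightarrow> real^'q::finite^'s \<Rightarrow> real" where
  "entropy_rate \<gamma> \<nu> =
     ln (real CARD('q)) + (\<Sum>k\<in>UNIV. \<gamma> k * (\<Sum>c\<in>UNIV. \<nu> $ k $ c * ln (\<nu> $ k $ c)))"

definition potts_rate ::
  "('s::finite \<Rightarrow> real) \<Rightarrow> real \<Rightarrow> real \<Rightarrow> real^'q::finite^'s \<Rightarrow> ereal" where
  "potts_rate \<gamma> \<alpha> \<beta> \<nu> =
     (let F = (\<lambda>\<mu>::real^'q^'s.
            1/2 * form_wrt (interaction_matrix \<alpha> \<beta>) (diag_matrix \<gamma> ** \<mu>) (diag_matrix \<gamma> ** \<mu>)
            - entropy_rate \<gamma> \<mu>)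
      in if \<nu> \<in> prob_rows
         then - ereal (F \<nu>) + (SUP \<mu>\<in>prob_rows. ereal (F \<mu>))
         else \<infinity>)"

definition explicit_functional ::
  "('s::finite \<Rightarrow> real) \<Rightarrow> real \<Rightarrow> real \<Rightarrow> real^'q::finite^'s \<Rightarrow> real" where
  "explicit_functional \<gamma> \<alpha> \<beta> \<nu> =
     \<beta> / 2 * (\<Sum>c\<in>UNIV. \<Sum>k\<in>UNIV. (\<gamma> k)\<^sup>2 * (\<nu> $ k $ c)\<^sup>2)
     + \<alpha> / 2 * (\<Sum>c\<in>UNIV. \<Sum>(k, k')\<in>{(k, k'). k \<noteq> k'}. \<gamma> k * \<gamma> k' * \<nu> $ k $ c * \<nu> $ k' $ c)
     - entropy_rate \<gamma> \<nu>"

end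

theory Submission
  imports Defs "HOL-Real_Asymp.Real_Asymp"
begin

text \<open>
  The Hamiltonian equals \<open>- N\<close> times a quadratic form of \<open>M\<^sub>N\<close>, and \<open>M\<^sub>N\<close> takes only polynomially
  many values, so everything reduces to counting, on the exponential scale, the configurations
  with \<open>M\<^sub>N\<close> close to a given \<open>\<nu>\<close>. Both counting bounds come from the product measure in which the
  spins of block \<open>k\<close> have law \<open>\<nu>\<^sub>k\<close>. The configurations with \<open>M\<^sub>N = \<nu>\<close> all have the same weight
  there, and total mass 1 bounds their number from above. The values of \<open>M\<^sub>N\<close> at distance at least
  \<open>r\<close> from \<open>\<nu>\<close> are exponentially unlikely, because relative entropy dominates a multiple of the
  squared distance, so half of the mass lies near \<open>\<nu>\<close>, where every weight is nearly the same; this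
  bounds the number of nearby configurations from below.
\<close>

section \<open>Configurations and their types\<close>

text \<open>Identities at fixed \<open>N\<close> are stated with these proportions and are therefore
  exact. The replacement by the limits \<open>\<gamma>\<close> happens later, with errors uniform
  over \<open>prob_rows\<close>.\<close>

definition block_fraction :: "(nat \<Rightarrow> 's::finite \<Rightarrow> nat set) \<Rightarrow> nat \<Rightarrow> 's \<Rightarrow> real" where
  "block_fraction S N k = real (card (S N k)) / real N"

text \<open>
  The negative of a weighted sum of cross entropies of rows. This holds only if \<open>\<mu>\<close> vanishes
  wherever \<open>\<nu>\<close> does; elsewhere \<open>ln 0 = 0\<close> replaces the value \<open>-\<infinity>\<close>.
\<close>

definition cross :: "('s::finite \<Rightarrow> real) \<Rightarrow> real^'q::finite^'s \<Rightarrow> real^'q^'s \<Rightarrow> real" where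
  "cross g \<mu> \<nu> = (\<Sum>k\<in>UNIV. g k * (\<Sum>c\<in>UNIV. \<mu> $ k $ c * ln (\<nu> $ k $ c)))"

text \<open>An entrywise expansion of half the quadratic form in the rate function. The weights are
  a parameter because both the block proportions at finite \<open>N\<close> and their limits are
  inserted.\<close>

definition energy :: "('s::finite \<Rightarrow> real) \<Rightarrow> real \<Rightarrow> real \<Rightarrow> real^'q::finite^'s \<Rightarrow> real" where
  "energy g \<alpha> \<beta> \<mu> = 1/2 * (\<Sum>k\<in>UNIV. \<Sum>k'\<in>UNIV.
     (if k = k' then \<beta> else \<alpha>) * (g k * g k') * (\<Sum>c\<in>UNIV. \<mu> $ k $ c * \<mu> $ k' $ c))"

lemma finite_configs [simp]: "finite (configs N :: (nat \<Rightarrow> 'q::finite) set)"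
  by (auto simp: configs_def intro: finite_PiE)

lemma configs_nonempty [simp]: "(configs N :: (nat \<Rightarrow> 'q::finite) set) \<noteq> {}"
  by (auto simp: configs_def PiE_eq_empty_iff)

lemma block_finite: "block_partition S \<Longrightarrow> finite (S N k)"
  by (rule finite_subset[of _ "{1..N}"]) (auto simp: block_partition_def)

lemma block_unique:
  assumes "block_partition S" "i \<in> S N k" "i \<in> S N k'"
  shows "k = k'"
  using assms disjoint_family_onD[of "S N" UNIV k k'] by (auto simp: block_partition_def)

lemma sum_blocks:
  fixes S :: "nat \<Rightarrow> 's::finite \<Rightarrow> nat set"
  assumes "block_partition S"
  shows "(\<Sum>i\<in>{1..N}. f i) = (\<Sum>k\<in>UNIV. \<Sum>i\<in>S N k. f i)"
proof -
  have "{1..N} = (\<Union>k. S N k)" "disjoint_family (S N)"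
    using assms by (auto simp: block_partition_def)
  then show ?thesis
    using block_finite[OF assms] by (simp add: sum.UNION_disjoint disjoint_family_on_def)
qed

text \<open>With the denominator cleared, the identity also covers an empty block, where both sides
  vanish.\<close>

lemma card_block_order_parameter:
  assumes "block_partition S"
  shows "real (card (S N k)) * order_parameter S N \<omega> $ k $ c = (\<Sum>i\<in>S N k. of_bool (\<omega> i = c))"
  using block_finite[OF assms, of N k] by (cases "S N k = {}") (auto simp: order_parameter_def)

lemma sum_colours:
  fixes \<omega> :: "nat \<Rightarrow> 'q::finite" and g :: "'q \<Rightarrow> real"
  assumes "block_partition S"
  shows "(\<Sum>i\<in>S N k. g (\<omega> i)) = real (card (S N k)) * (\<Sum>c\<in>UNIV. order_parameter S N \<omega> $ k $ c * g c)"
proof -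
  have "(\<Sum>i\<in>S N k. g (\<omega> i)) = (\<Sum>i\<in>S N k. \<Sum>c\<in>UNIV. of_bool (\<omega> i = c) * g c)"
    by simp
  also have "\<dots> = (\<Sum>c\<in>UNIV. real (card (S N k)) * order_parameter S N \<omega> $ k $ c * g c)"
    by (subst sum.swap) (simp only: card_block_order_parameter[OF assms] sum_distrib_right)
  finally show ?thesis
    by (simp add: sum_distrib_left mult.assoc)
qed

lemma card_block: "real (card (S N k)) = real N * block_fraction S N k" if "N > 0"
  using that by (simp add: block_fraction_def)

text \<open>The log-likelihood of a configuration under independent spins depends on it only through
  the order parameter. This is why configurations can be counted type by type.\<close>

lemma sum_blocks_colours:
  fixes \<omega> :: "nat \<Rightarrow> 'q::finite" and S :: "nat \<Rightarrow> 's::finite \<Rightarrow> nat set"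
  assumes "block_partition S" "N > 0"
  shows "(\<Sum>k\<in>UNIV. \<Sum>i\<in>S N k. ln (\<nu> $ k $ \<omega> i))
     = real N * cross (block_fraction S N) (order_parameter S N \<omega>) \<nu>"
  unfolding sum_colours[OF assms(1), where g = "\<lambda>c. ln (\<nu> $ _ $ c)"] cross_def sum_distrib_left card_block[OF assms(2)]
  by (simp add: mult_ac)

lemma block_fraction_bounds:
  assumes "block_partition S"
  shows "0 \<le> block_fraction S N k" "block_fraction S N k \<le> 1"
proof -
  have "S N k \<subseteq> {1..N}" using assms by (auto simp: block_partition_def)
  then have "card (S N k) \<le> N" using card_mono[of "{1..N}" "S N k"] by simp
  then show "block_fraction S N k \<le> 1" by (simp add: block_fraction_def divide_le_eq_1) linarith
qed (simp add: block_fraction_def)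

lemma order_parameter_prob_rows:
  assumes "block_partition S" "\<And>k. S N k \<noteq> {}"
  shows "order_parameter S N \<omega> \<in> prob_rows"
proof -
  have "(\<Sum>c\<in>UNIV. order_parameter S N \<omega> $ k $ c) = 1" for k
    using sum_colours[OF assms(1), of "\<lambda>_. 1" \<omega> N k] block_finite[OF assms(1), of N k] assms(2)[of k]
    by simp
  then show ?thesis
    by (auto simp: prob_rows_def order_parameter_def intro!: divide_nonneg_nonneg sum_nonneg)
qed

lemma prob_rows_le1: "\<nu> \<in> prob_rows \<Longrightarrow> \<nu> $ k $ c \<le> 1"
  using member_le_sum[of c UNIV "\<lambda>c. \<nu> $ k $ c"] by (auto simp: prob_rows_def)

text \<open>Group the pairs of vertices by their blocks. The number of equal-coloured pairs between
  two blocks is the product of the block sizes times the inner product of the two rows of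
  \<open>M_N\<close>. Since the pairs with \<open>i = j\<close> belong to the Hamiltonian, the
  identity has no diagonal correction.\<close>

lemma hamiltonian_energy:
  fixes \<omega> :: "nat \<Rightarrow> 'q::finite" and S :: "nat \<Rightarrow> 's::finite \<Rightarrow> nat set"
  assumes S: "block_partition S" and N: "N > 0"
  shows "- hamiltonian S \<alpha> \<beta> N \<omega> = real N * energy (block_fraction S N) \<alpha> \<beta> (order_parameter S N \<omega>)"
proof -
  let ?a = "\<lambda>i j. if same_block S N i j then \<beta> else \<alpha>"
  let ?A = "\<lambda>k k'. if k = k' then \<beta> else \<alpha>"
  let ?m = "order_parameter S N \<omega>"
  let ?e = "\<lambda>i j. of_bool (\<omega> i = \<omega> j) :: real"
  have split: "(\<Sum>(i, j) \<in> {(i, j) \<in> {1..N} \<times> {1..N}. P i j}. ?e i j)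
     = (\<Sum>i\<in>{1..N}. \<Sum>j\<in>{1..N}. if P i j then ?e i j else 0)" for P
  proof -
    have "{(i, j) \<in> {1..N} \<times> {1..N}. P i j} = {x \<in> {1..N} \<times> {1..N}. P (fst x) (snd x)}" by auto
    then show ?thesis
      by (simp only: sum.inter_filter finite_cartesian_product finite_atLeastAtMost sum.cartesian_product case_prod_unfold)
  qed
  have "- hamiltonian S \<alpha> \<beta> N \<omega> = 1 / (2 * real N) * (\<Sum>i\<in>{1..N}. \<Sum>j\<in>{1..N}. ?a i j * ?e i j)"
  proof -
    have "(\<Sum>i\<in>{1..N}. \<Sum>j\<in>{1..N}. ?a i j * ?e i j) =
      \<beta> * (\<Sum>i\<in>{1..N}. \<Sum>j\<in>{1..N}. if same_block S N i j then ?e i j else 0) +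
      \<alpha> * (\<Sum>i\<in>{1..N}. \<Sum>j\<in>{1..N}. if \<not> same_block S N i j then ?e i j else 0)"
      unfolding sum_distrib_left sum.distrib[symmetric] by (intro sum.cong) auto
    then show ?thesis unfolding hamiltonian_def split using N by (simp add: field_simps)
  qed
  also have "(\<Sum>i\<in>{1..N}. \<Sum>j\<in>{1..N}. ?a i j * ?e i j)
     = (\<Sum>k\<in>UNIV. \<Sum>i\<in>S N k. \<Sum>k'\<in>UNIV. \<Sum>j\<in>S N k'. ?a i j * ?e i j)"
    by (simp only: sum_blocks[OF S])
  also have "\<dots> = (\<Sum>k\<in>UNIV. \<Sum>i\<in>S N k. \<Sum>k'\<in>UNIV. \<Sum>j\<in>S N k'. ?A k k' * ?e i j)"
  proof (intro sum.cong refl)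
    fix k i k' j assume "i \<in> S N k" "j \<in> S N k'"
    then have "same_block S N i j \<longleftrightarrow> k = k'"
      unfolding same_block_def using block_unique[OF S] by metis
    then show "?a i j * ?e i j = ?A k k' * ?e i j" by simp
  qed
  also have "\<dots> = (\<Sum>k\<in>UNIV. \<Sum>k'\<in>UNIV. ?A k k' * (\<Sum>i\<in>S N k. \<Sum>j\<in>S N k'. ?e i j))"
    by (subst sum.swap) (simp only: sum_distrib_left)
  also have "\<dots> = (\<Sum>k\<in>UNIV. \<Sum>k'\<in>UNIV. ?A k k' * (real (card (S N k)) * real (card (S N k'))) *
      (\<Sum>c\<in>UNIV. ?m $ k $ c * ?m $ k' $ c))"
  proof (intro sum.cong refl)
    fix k k'
    \<comment> \<open>For fixed \<open>i\<close>, the sum over \<open>j\<close> counts the vertices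
      of block \<open>k'\<close> with colour \<open>\<omega> i\<close>. What remains is a function
      of \<open>\<omega> i\<close> alone, so the sum over \<open>i\<close> can be sorted by
      colour.\<close>
    have "(\<Sum>i\<in>S N k. \<Sum>j\<in>S N k'. ?e i j)
        = (\<Sum>i\<in>S N k. real (card (S N k')) * ?m $ k' $ \<omega> i)"
      by (simp only: card_block_order_parameter[OF S]) (simp only: eq_commute)
    also have "\<dots> = real (card (S N k)) * (\<Sum>c\<in>UNIV. ?m $ k $ c * (real (card (S N k')) * ?m $ k' $ c))"
      by (rule sum_colours[OF S])
    finally show "?A k k' * (\<Sum>i\<in>S N k. \<Sum>j\<in>S N k'. ?e i j) =
      ?A k k' * (real (card (S N k)) * real (card (S N k'))) * (\<Sum>c\<in>UNIV. ?m $ k $ c * ?m $ k' $ c)"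
      by (simp add: sum_distrib_left mult_ac)
  qed
  finally show ?thesis using N
    by (simp add: card_block[OF N] energy_def sum_distrib_left field_simps)
qed

section \<open>Product measures with a prescribed spin law in each block\<close>

definition tilt :: "(nat \<Rightarrow> 's::finite \<Rightarrow> nat set) \<Rightarrow> nat \<Rightarrow> real^'q::finite^'s \<Rightarrow> (nat \<Rightarrow> 'q) \<Rightarrow> real" where
  "tilt S N \<nu> \<omega> = (\<Prod>k\<in>UNIV. \<Prod>i\<in>S N k. \<nu> $ k $ \<omega> i)"

lemma tilt_nonneg: "\<nu> \<in> prob_rows \<Longrightarrow> 0 \<le> tilt S N \<nu> \<omega>"
  by (auto simp: tilt_def prob_rows_def intro!: prod_nonneg)

text \<open>Rewritten over single vertices, the weight is one factor per vertex, and summing over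
  all configurations gives a product of row sums, each equal to 1.\<close>

lemma sum_tilt:
  fixes S :: "nat \<Rightarrow> 's::finite \<Rightarrow> nat set" and \<nu> :: "real^'q::finite^'s"
  assumes S: "block_partition S" and \<nu>: "\<nu> \<in> prob_rows"
  shows "(\<Sum>\<omega>\<in>configs N. tilt S N \<nu> \<omega>) = 1"
proof -
  define b where "b i = (THE k. i \<in> S N k)" for i
  have b: "b i = k" if "i \<in> S N k" for i k
    unfolding b_def
  proof (rule the_equality)
    show "i \<in> S N k" by (rule that)
  next
    fix k' assume "i \<in> S N k'"
    then show "k' = k" using that block_unique[OF S] by metis
  qed
  have "tilt S N \<nu> \<omega> = (\<Prod>i\<in>{1..N}. \<nu> $ b i $ \<omega> i)" for \<omega>
  proof -
    have "{1..N} = (\<Union>k. S N k)" "disjoint_family (S N)"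
      using S by (auto simp: block_partition_def)
    then have "(\<Prod>i\<in>{1..N}. \<nu> $ b i $ \<omega> i) = (\<Prod>k\<in>UNIV. \<Prod>i\<in>S N k. \<nu> $ b i $ \<omega> i)"
      using block_finite[OF S] by (simp add: prod.UNION_disjoint disjoint_family_on_def)
    then show ?thesis by (simp add: tilt_def b)
  qed
  then have "(\<Sum>\<omega>\<in>configs N. tilt S N \<nu> \<omega>) = (\<Prod>i\<in>{1..N}. \<Sum>c\<in>UNIV. \<nu> $ b i $ c)"
    unfolding configs_def by (simp add: prod_sum_PiE)
  also have "\<dots> = 1" using \<nu> by (simp add: prob_rows_def)
  finally show ?thesis .
qed

text \<open>The weight must be nonzero: since \<open>ln 0 = 0\<close>, a vanishing factor would
  appear on the right as \<open>exp 0 = 1\<close>.\<close>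

lemma tilt_eq_exp_cross:
  fixes S :: "nat \<Rightarrow> 's::finite \<Rightarrow> nat set" and \<nu> :: "real^'q::finite^'s"
  assumes "block_partition S" "N > 0" "\<nu> \<in> prob_rows" "tilt S N \<nu> \<omega> \<noteq> 0"
  shows "tilt S N \<nu> \<omega> = exp (real N * cross (block_fraction S N) (order_parameter S N \<omega>) \<nu>)"
proof -
  have "\<nu> $ k $ \<omega> i > 0" if "i \<in> S N k" for k i
    using assms(3,4) that block_finite[OF assms(1)] unfolding tilt_def prob_rows_def
    by (simp add: order_less_le)
  then show ?thesis
    unfolding sum_blocks_colours[OF assms(1,2), symmetric] tilt_def
    by (simp add: exp_sum block_finite[OF assms(1)])
qed

text \<open>Nonzero weight means that the rows of \<open>M_N\<close> are absolutely continuous with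
  respect to those of \<open>\<nu>\<close>. This is the condition under which \<open>cross\<close>
  is a genuine cross entropy.\<close>

lemma tilt_support:
  fixes S :: "nat \<Rightarrow> 's::finite \<Rightarrow> nat set" and \<nu> :: "real^'q::finite^'s"
  assumes S: "block_partition S"
  shows "tilt S N \<nu> \<omega> \<noteq> 0 \<longleftrightarrow> (\<forall>k c. \<nu> $ k $ c = 0 \<longrightarrow> order_parameter S N \<omega> $ k $ c = 0)"
proof -
  have fin: "finite (S N k)" for k by (rule block_finite[OF S])
  have "order_parameter S N \<omega> $ k $ c = 0 \<longleftrightarrow> (\<forall>i\<in>S N k. \<omega> i \<noteq> c)" for k c
    using fin[of k] by (auto simp: order_parameter_def sum_nonneg_eq_0_iff)
  then show ?thesis by (simp add: tilt_def fin) blast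
qed

section \<open>Counting configurations by type\<close>

lemma card_type_le:
  fixes S :: "nat \<Rightarrow> 's::finite \<Rightarrow> nat set" and \<mu> :: "real^'q::finite^'s"
  assumes S: "block_partition S" and N: "N > 0" and \<mu>: "\<mu> \<in> prob_rows"
  shows "real (card {\<omega>\<in>configs N. order_parameter S N \<omega> = \<mu>})
     \<le> exp (- real N * cross (block_fraction S N) \<mu> \<mu>)"
proof -
  let ?X = "{\<omega>\<in>configs N. order_parameter S N \<omega> = \<mu>}"
  \<comment> \<open>The law is \<open>\<mu>\<close> itself, so the support condition is trivial and
    every configuration of type \<open>\<mu>\<close> has nonzero weight.\<close>
  have "real (card ?X) * exp (real N * cross (block_fraction S N) \<mu> \<mu>) = (\<Sum>\<omega>\<in>?X. tilt S N \<mu> \<omega>)"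
    using tilt_eq_exp_cross[OF S N \<mu>] by (simp add: tilt_support[OF S])
  also have "\<dots> \<le> (\<Sum>\<omega>\<in>configs N. tilt S N \<mu> \<omega>)"
    using tilt_nonneg[OF \<mu>] by (intro sum_mono2) auto
  finally show ?thesis
    by (simp add: sum_tilt[OF S \<mu>] exp_minus field_simps)
qed

text \<open>A type is determined by the number of vertices of each colour in each block, and each
  such number lies between 0 and \<open>N\<close>.\<close>

lemma card_types_le:
  fixes S :: "nat \<Rightarrow> 's::finite \<Rightarrow> nat set"
  assumes S: "block_partition S"
  shows "card ((order_parameter S N :: _ \<Rightarrow> real^'q::finite^'s) ` configs N) \<le> (N + 1) ^ (CARD('s) * CARD('q))"
proof -
  define F where "F = (\<lambda>f::'s \<times> 'q \<Rightarrow> nat. (\<chi> k c. 1 / real (card (S N k)) * real (f (k, c))) :: real^'q^'s)"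
  have "(order_parameter S N :: _ \<Rightarrow> real^'q^'s) ` configs N \<subseteq> F ` (UNIV \<rightarrow>\<^sub>E {..N})"
  proof safe
    fix \<omega> :: "nat \<Rightarrow> 'q"
    define f where "f = (\<lambda>(k, c). card {i\<in>S N k. \<omega> i = c})"
    have "f x \<le> N" for x
    proof -
      have "{i\<in>S N (fst x). \<omega> i = snd x} \<subseteq> {1..N}"
        using S by (auto simp: block_partition_def)
      from card_mono[OF _ this] show ?thesis by (simp add: f_def case_prod_unfold)
    qed
    moreover have "order_parameter S N \<omega> = F f"
      using block_finite[OF S] by (simp add: F_def f_def order_parameter_def vec_eq_iff sum.If_cases of_bool_def Int_def)
    ultimately show "order_parameter S N \<omega> \<in> F ` (UNIV \<rightarrow>\<^sub>E {..N})"
      by (intro image_eqI[of _ _ f]) auto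
  qed
  then have "card ((order_parameter S N :: _ \<Rightarrow> real^'q^'s) ` configs N) \<le> card ((UNIV :: ('s\<times>'q) set) \<rightarrow>\<^sub>E {..N})"
    by (meson surj_card_le finite_PiE finite_atMost finite)
  then show ?thesis by (simp add: card_PiE card_cartesian_product flip: UNIV_Times_UNIV)
qed

text \<open>Group by type: each type has at most \<open>exp (- N * cross)\<close> configurations,
  and the number of types is polynomial in \<open>N\<close>. The bound serves twice, with
  \<open>\<phi>\<close> a cross entropy for the tails of a product measure, and with
  \<open>\<phi>\<close> the energy for Boltzmann sums.\<close>

lemma type_sum_le:
  fixes S :: "nat \<Rightarrow> 's::finite \<Rightarrow> nat set" and \<phi> :: "real^'q::finite^'s \<Rightarrow> real"
  assumes S: "block_partition S" and N: "N > 0" and ne: "\<And>k. S N k \<noteq> {}" and X: "X \<subseteq> configs N"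
    and le: "\<And>\<omega>. \<omega> \<in> X \<Longrightarrow>
       \<phi> (order_parameter S N \<omega>) - cross (block_fraction S N) (order_parameter S N \<omega>) (order_parameter S N \<omega>) \<le> L"
  shows "(\<Sum>\<omega>\<in>X. exp (real N * \<phi> (order_parameter S N \<omega>)))
     \<le> real ((N + 1) ^ (CARD('s) * CARD('q))) * exp (real N * L)"
proof -
  let ?M = "order_parameter S N :: _ \<Rightarrow> real^'q^'s"
  have finX: "finite X" using X finite_subset finite_configs by blast
  have "(\<Sum>\<omega>\<in>X. exp (real N * \<phi> (?M \<omega>)))
     = (\<Sum>\<mu>\<in>?M ` X. \<Sum>\<omega>\<in>{\<omega>\<in>X. ?M \<omega> = \<mu>}. exp (real N * \<phi> (?M \<omega>)))"
    by (rule sum.image_gen[OF finX])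
  also have "\<dots> \<le> (\<Sum>\<mu>\<in>?M ` X. exp (real N * L))"
  proof (rule sum_mono)
    fix \<mu> assume "\<mu> \<in> ?M ` X"
    then obtain \<omega>0 where w: "\<omega>0 \<in> X" "\<mu> = ?M \<omega>0" by auto
    have "(\<Sum>\<omega>\<in>{\<omega>\<in>X. ?M \<omega> = \<mu>}. exp (real N * \<phi> (?M \<omega>)))
       = real (card {\<omega>\<in>X. ?M \<omega> = \<mu>}) * exp (real N * \<phi> \<mu>)" by simp
    also have "\<dots> \<le> real (card {\<omega>\<in>configs N. ?M \<omega> = \<mu>}) * exp (real N * \<phi> \<mu>)"
      using X by (intro mult_right_mono of_nat_mono card_mono) auto
    also have "\<dots> \<le> exp (- real N * cross (block_fraction S N) \<mu> \<mu>) * exp (real N * \<phi> \<mu>)"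
      using order_parameter_prob_rows[OF S ne] w(2)
      by (intro mult_right_mono card_type_le[OF S N]) auto
    also have "\<dots> = exp (real N * (\<phi> \<mu> - cross (block_fraction S N) \<mu> \<mu>))"
      by (simp add: exp_add[symmetric] algebra_simps)
    also have "\<dots> \<le> exp (real N * L)"
      using le[OF w(1)] w(2) by (simp add: mult_left_mono)
    finally show "(\<Sum>\<omega>\<in>{\<omega>\<in>X. ?M \<omega> = \<mu>}. exp (real N * \<phi> (?M \<omega>))) \<le> exp (real N * L)" .
  qed
  also have "\<dots> = real (card (?M ` X)) * exp (real N * L)" by simp
  also have "\<dots> \<le> real ((N + 1) ^ (CARD('s) * CARD('q))) * exp (real N * L)"
  proof (intro mult_right_mono of_nat_mono)
    have "card (?M ` X) \<le> card (?M ` configs N)"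
      using X by (intro card_mono image_mono finite_imageI finite_configs)
    then show "card (?M ` X) \<le> (N + 1) ^ (CARD('s) * CARD('q))"
      using card_types_le[OF S, where 'q='q, of N] by linarith
  qed simp
  finally show ?thesis .
qed

section \<open>Relative entropy dominates squared distance\<close>

lemma mult_ln_quotient_ge:
  fixes x y :: real
  assumes "0 \<le> x" "0 \<le> y" "y = 0 \<Longrightarrow> x = 0" "x \<le> 1" "y \<le> 1"
  shows "x * ln y - x * ln x \<le> y - x - (x - y)\<^sup>2 / 4"
proof (cases "x = 0")
  case True
  have "y\<^sup>2 \<le> y" using assms by (simp add: power2_eq_square mult_left_le)
  then show ?thesis using True assms by simp
next
  case False
  then have pos: "x > 0" "y > 0" using assms by (auto simp: order_less_le)
  \<comment> \<open>Apply \<open>ln t \<le> t - 1\<close> to \<open>t = sqrt (y / x)\<close>: this gives the squared Hellinger distance.\<close>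
  define a where "a = sqrt x"
  define b where "b = sqrt y"
  have ab: "x = a\<^sup>2" "y = b\<^sup>2" "0 < a" "a \<le> 1" "0 < b" "b \<le> 1" using assms pos by (auto simp: a_def b_def)
  have "ln b - ln a \<le> b / a - 1"
    using ln_le_minus_one[of "b / a"] ab by (simp add: ln_div)
  then have "x * ln y - x * ln x \<le> 2 * a\<^sup>2 * (b / a - 1)"
    using mult_left_mono[of "ln b - ln a" "b / a - 1" "2 * a\<^sup>2"] ab
    by (simp add: ln_realpow algebra_simps)
  also have "\<dots> = b\<^sup>2 - a\<^sup>2 - (a - b)\<^sup>2"
    using ab by (simp add: power2_eq_square field_simps)
  also have "\<dots> \<le> b\<^sup>2 - a\<^sup>2 - (a\<^sup>2 - b\<^sup>2)\<^sup>2 / 4"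
  proof -
    \<comment> \<open>The factor \<open>a + b\<close>, at most 2, converts the Hellinger distance
      into the Euclidean one and is the source of the constant 4.\<close>
    have "(a + b)\<^sup>2 \<le> 4" using power_mono[of "a + b" 2 2] ab by simp
    then have "(a - b)\<^sup>2 * (a + b)\<^sup>2 \<le> (a - b)\<^sup>2 * 4" by (intro mult_left_mono) auto
    moreover have "(a\<^sup>2 - b\<^sup>2)\<^sup>2 = (a - b)\<^sup>2 * (a + b)\<^sup>2" by (simp add: power2_eq_square algebra_simps)
    ultimately show ?thesis by simp
  qed
  finally show ?thesis by (simp add: ab)
qed

text \<open>The left side is minus the weighted sum of the relative entropies of the rows of
  \<open>\<mu>\<close> with respect to those of \<open>\<nu>\<close>. In each row the linear terms
  of the pointwise bound cancel because both rows sum to 1, leaving an inequality of Pinsker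
  type.\<close>

lemma cross_diff_le:
  assumes "\<mu> \<in> prob_rows" "\<nu> \<in> prob_rows" "\<And>k c. \<nu> $ k $ c = 0 \<Longrightarrow> \<mu> $ k $ c = 0"
    and "0 \<le> g" "\<And>k. g \<le> h k"
  shows "cross h \<mu> \<nu> - cross h \<mu> \<mu> \<le> - g * (dist \<mu> \<nu>)\<^sup>2 / 4"
proof -
  have row: "(\<Sum>c\<in>UNIV. \<mu> $ k $ c * ln (\<nu> $ k $ c)) - (\<Sum>c\<in>UNIV. \<mu> $ k $ c * ln (\<mu> $ k $ c))
      \<le> - (\<Sum>c\<in>UNIV. (\<mu> $ k $ c - \<nu> $ k $ c)\<^sup>2) / 4" for k
  proof -
    have "(\<Sum>c\<in>UNIV. \<mu> $ k $ c * ln (\<nu> $ k $ c) - \<mu> $ k $ c * ln (\<mu> $ k $ c)) \<le>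
       (\<Sum>c\<in>UNIV. \<nu> $ k $ c - \<mu> $ k $ c - (\<mu> $ k $ c - \<nu> $ k $ c)\<^sup>2 / 4)"
      using assms prob_rows_le1[OF assms(1)] prob_rows_le1[OF assms(2)]
      by (intro sum_mono mult_ln_quotient_ge) (auto simp: prob_rows_def)
    also have "\<dots> = - (\<Sum>c\<in>UNIV. (\<mu> $ k $ c - \<nu> $ k $ c)\<^sup>2) / 4"
      using assms by (simp add: sum_subtractf prob_rows_def sum_divide_distrib)
    finally show ?thesis by (simp add: sum_subtractf)
  qed
  have "(dist \<mu> \<nu>)\<^sup>2 = (\<Sum>k\<in>UNIV. \<Sum>c\<in>UNIV. (\<mu> $ k $ c - \<nu> $ k $ c)\<^sup>2)"
    unfolding dist_norm power2_norm_eq_inner by (simp add: inner_vec_def power2_eq_square)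
  moreover have "cross h \<mu> \<nu> - cross h \<mu> \<mu> = (\<Sum>k\<in>UNIV. h k *
     ((\<Sum>c\<in>UNIV. \<mu> $ k $ c * ln (\<nu> $ k $ c)) - (\<Sum>c\<in>UNIV. \<mu> $ k $ c * ln (\<mu> $ k $ c))))"
    by (simp add: cross_def sum_subtractf right_diff_distrib)
  moreover have "\<dots> \<le> (\<Sum>k\<in>UNIV. h k * (- (\<Sum>c\<in>UNIV. (\<mu> $ k $ c - \<nu> $ k $ c)\<^sup>2) / 4))"
    using assms(4,5) order_trans by (intro sum_mono mult_left_mono row) blast
  moreover have "\<dots> \<le> (\<Sum>k\<in>UNIV. g * (- (\<Sum>c\<in>UNIV. (\<mu> $ k $ c - \<nu> $ k $ c)\<^sup>2) / 4))"
    using assms(5) by (intro sum_mono mult_right_mono_neg) (auto intro: sum_nonneg)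
  ultimately show ?thesis by (simp add: sum_negf sum_divide_distrib[symmetric] sum_distrib_left[symmetric])
qed

section \<open>Uniform asymptotics\<close>

text \<open>Applying \<open>ln t \<le> t - 1\<close> to \<open>t = 1 / x\<close> gives
  \<open>x - 1 \<le> x * ln x \<le> 0\<close> on the half-open unit interval.\<close>

lemma abs_mult_ln_le_1:
  fixes x :: real
  assumes "0 \<le> x" "x \<le> 1"
  shows "\<bar>x * ln x\<bar> \<le> 1"
proof (cases "x = 0")
  case False
  then have "1 - 1 / x \<le> ln x" using ln_le_minus_one[of "1 / x"] assms by (simp add: ln_div)
  then have "x * (1 - 1 / x) \<le> x * ln x" using assms by (intro mult_left_mono)
  moreover have "x * ln x \<le> 0" using assms False by (simp add: mult_nonneg_nonpos)
  ultimately show ?thesis using False assms by (simp add: algebra_simps)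
qed simp

text \<open>Although \<open>ln\<close> is unbounded near 0, the entropy of a row is bounded, so the
  estimate is free of \<open>\<mu>\<close>. Uniformity matters because it is applied to types that
  vary with \<open>N\<close>.\<close>

lemma cross_self_weight_diff:
  fixes \<mu> :: "real^'q::finite^'s::finite"
  assumes "\<mu> \<in> prob_rows"
  shows "\<bar>cross g \<mu> \<mu> - cross h \<mu> \<mu>\<bar> \<le> real CARD('q) * (\<Sum>k\<in>UNIV. \<bar>g k - h k\<bar>)"
proof -
  have "\<bar>\<Sum>c\<in>UNIV. \<mu> $ k $ c * ln (\<mu> $ k $ c)\<bar> \<le> real CARD('q)" for k
  proof -
    have "\<bar>\<Sum>c\<in>UNIV. \<mu> $ k $ c * ln (\<mu> $ k $ c)\<bar> \<le> (\<Sum>c\<in>(UNIV::'q set). 1)"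
      using assms prob_rows_le1[OF assms]
      by (intro sum_abs[THEN order_trans] sum_mono abs_mult_ln_le_1) (auto simp: prob_rows_def)
    then show ?thesis by simp
  qed
  note row = this
  have "\<bar>cross g \<mu> \<mu> - cross h \<mu> \<mu>\<bar>
    = \<bar>\<Sum>k\<in>UNIV. (g k - h k) * (\<Sum>c\<in>UNIV. \<mu> $ k $ c * ln (\<mu> $ k $ c))\<bar>"
    unfolding cross_def sum_subtractf left_diff_distrib ..
  also have "\<dots> \<le> (\<Sum>k\<in>UNIV. \<bar>g k - h k\<bar> * real CARD('q))"
    unfolding abs_mult
    by (intro sum_abs[THEN order_trans] sum_mono) (simp add: abs_mult mult_left_mono row)
  finally show ?thesis by (simp add: sum_distrib_left mult.commute)
qed

lemma energy_weight_diff: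
  fixes \<mu> :: "real^'q::finite^'s::finite"
  assumes "\<mu> \<in> prob_rows"
  shows "\<bar>energy g \<alpha> \<beta> \<mu> - energy h \<alpha> \<beta> \<mu>\<bar>
    \<le> (\<Sum>k\<in>UNIV. \<Sum>k'\<in>UNIV. \<bar>if k = k' then \<beta> else \<alpha>\<bar> * \<bar>g k * g k' - h k * h k'\<bar> * real CARD('q))"
proof -
  let ?A = "\<lambda>k k'. if k = k' then \<beta> else \<alpha>"
  let ?p = "\<lambda>k k'. \<Sum>c\<in>UNIV. \<mu> $ k $ c * \<mu> $ k' $ c"
  have p: "\<bar>?p k k'\<bar> \<le> real CARD('q)" for k k'
  proof -
    have "\<bar>?p k k'\<bar> \<le> (\<Sum>c\<in>(UNIV::'q set). 1)"
      using assms prob_rows_le1[OF assms]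
      by (intro sum_abs[THEN order_trans] sum_mono) (auto simp: prob_rows_def abs_mult intro!: mult_le_one)
    then show ?thesis by simp
  qed
  have "energy g \<alpha> \<beta> \<mu> - energy h \<alpha> \<beta> \<mu>
    = 1/2 * (\<Sum>k\<in>UNIV. \<Sum>k'\<in>UNIV. ?A k k' * (g k * g k' - h k * h k') * ?p k k')"
    unfolding energy_def right_diff_distrib left_diff_distrib sum_subtractf by simp
  then have "\<bar>energy g \<alpha> \<beta> \<mu> - energy h \<alpha> \<beta> \<mu>\<bar>
    \<le> \<bar>\<Sum>k\<in>UNIV. \<Sum>k'\<in>UNIV. ?A k k' * (g k * g k' - h k * h k') * ?p k k'\<bar>"
    by (simp add: abs_mult)
  also have "\<dots> \<le> (\<Sum>k\<in>UNIV. \<Sum>k'\<in>UNIV. \<bar>?A k k' * (g k * g k' - h k * h k') * ?p k k'\<bar>)"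
    by (intro sum_abs[THEN order_trans] sum_mono sum_abs)
  also have "\<dots> \<le> (\<Sum>k\<in>UNIV. \<Sum>k'\<in>UNIV. \<bar>?A k k'\<bar> * \<bar>g k * g k' - h k * h k'\<bar> * real CARD('q))"
    unfolding abs_mult by (intro sum_mono mult_left_mono p[unfolded abs_mult]) auto
  finally show ?thesis .
qed

text \<open>The value 0 at the origin is the continuous extension, so entropies are continuous up to
  the boundary of the simplex.\<close>

lemma continuous_on_mult_ln: "continuous_on {0..} (\<lambda>x::real. x * ln x)"
proof -
  have "((\<lambda>x::real. x * ln x) \<longlongrightarrow> 0) (at_right 0)" by real_asymp
  then have "((\<lambda>x::real. x * ln x) \<longlongrightarrow> 0) (at 0 within {0..})"
    by (simp add: at_within_Ici_at_right)
  then have "continuous (at x within {0..}) (\<lambda>x::real. x * ln x)" if "x \<ge> 0" for x :: real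
    using that by (cases "x = 0") (auto simp: continuous_within intro!: tendsto_eq_intros)
  then show ?thesis by (simp add: continuous_on_eq_continuous_within)
qed

lemma continuous_on_entry: "continuous_on A (\<lambda>\<mu>::real^'q::finite^'s::finite. \<mu> $ k $ c)"
  by (intro continuous_intros)

lemma continuous_on_cross: "continuous_on prob_rows (\<lambda>\<mu>::real^'q::finite^'s::finite. cross g \<mu> \<mu>)"
proof -
  have "continuous_on prob_rows (\<lambda>\<mu>::real^'q^'s. \<mu> $ k $ c * ln (\<mu> $ k $ c))" for k c
    by (rule continuous_on_compose2[OF continuous_on_mult_ln continuous_on_entry])
       (auto simp: prob_rows_def)
  then show ?thesis
    unfolding cross_def by (intro continuous_on_sum continuous_on_mult_left)
qed

lemma continuous_on_energy: "continuous_on A (energy g \<alpha> \<beta> :: real^'q::finite^'s::finite \<Rightarrow> real)"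
  unfolding energy_def by (intro continuous_intros)

lemma compact_prob_rows: "compact (prob_rows :: (real^'q::finite^'s::finite) set)"
proof (rule compact_eq_bounded_closed[THEN iffD2, OF conjI])
  have "norm \<mu> \<le> (\<Sum>k\<in>(UNIV::'s set). \<Sum>c\<in>(UNIV::'q set). 1)" if "\<mu> \<in> prob_rows" for \<mu> :: "real^'q^'s"
  proof -
    have "norm (\<mu> $ k) \<le> (\<Sum>c\<in>(UNIV::'q set). 1)" for k
    proof -
      have "norm (\<mu> $ k) \<le> (\<Sum>c\<in>UNIV. \<bar>\<mu> $ k $ c\<bar>)" by (rule norm_le_l1_cart)
      also have "\<dots> \<le> (\<Sum>c\<in>(UNIV::'q set). 1)"
        using that prob_rows_le1[OF that] by (intro sum_mono) (auto simp: prob_rows_def)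
      finally show ?thesis .
    qed
    then have "(\<Sum>k\<in>UNIV. norm (\<mu> $ k)) \<le> (\<Sum>k\<in>(UNIV::'s set). \<Sum>c\<in>(UNIV::'q set). 1)"
      by (intro sum_mono)
    moreover have "norm \<mu> \<le> (\<Sum>k\<in>UNIV. norm (\<mu> $ k))"
      unfolding norm_vec_def by (intro L2_set_le_sum) auto
    ultimately show ?thesis by linarith
  qed
  then show "bounded (prob_rows :: (real^'q^'s) set)" unfolding bounded_iff by blast
  show "closed (prob_rows :: (real^'q^'s) set)"
    unfolding prob_rows_def
    by (intro closed_Collect_all closed_Collect_conj closed_Collect_le closed_Collect_eq continuous_intros)
qed

lemma prob_rows_nonempty: "(prob_rows :: (real^'q::finite^'s::finite) set) \<noteq> {}"
proof -
  have "(\<chi> k c. 1 / real CARD('q)) \<in> (prob_rows :: (real^'q^'s) set)"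
    by (simp add: prob_rows_def)
  then show ?thesis by blast
qed

text \<open>For fixed \<open>\<nu>\<close> the expression is linear in \<open>\<mu>\<close>. The
  coefficients are finite even where \<open>\<nu>\<close> vanishes, by \<open>ln 0 = 0\<close>; the
  estimate is later used only on configurations of nonzero weight, where those entries of
  \<open>\<mu>\<close> vanish too.\<close>

lemma cross_near_diff:
  fixes \<mu> \<nu> :: "real^'q::finite^'s::finite"
  assumes "\<And>k. 0 \<le> g k" "\<And>k. g k \<le> 1"
  shows "\<bar>cross g \<mu> \<nu> - cross g \<nu> \<nu>\<bar> \<le> dist \<mu> \<nu> * (\<Sum>k\<in>UNIV. \<Sum>c\<in>UNIV. \<bar>ln (\<nu> $ k $ c)\<bar>)"
proof -
  have entry: "\<bar>\<mu> $ k $ c - \<nu> $ k $ c\<bar> \<le> dist \<mu> \<nu>" for k c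
    using component_le_norm_cart[of "\<mu> $ k - \<nu> $ k" c] Finite_Cartesian_Product.norm_nth_le[of "\<mu> - \<nu>" k]
    by (simp add: dist_norm)
  have "cross g \<mu> \<nu> - cross g \<nu> \<nu> = (\<Sum>k\<in>UNIV. \<Sum>c\<in>UNIV. g k * ((\<mu> $ k $ c - \<nu> $ k $ c) * ln (\<nu> $ k $ c)))"
    by (simp add: cross_def sum_subtractf right_diff_distrib left_diff_distrib sum_distrib_left)
  also have "\<bar>\<dots>\<bar> \<le> (\<Sum>k\<in>UNIV. \<Sum>c\<in>UNIV. \<bar>g k * ((\<mu> $ k $ c - \<nu> $ k $ c) * ln (\<nu> $ k $ c))\<bar>)"
    by (intro sum_abs[THEN order_trans] sum_mono sum_abs)
  also have "\<dots> \<le> (\<Sum>k\<in>UNIV. \<Sum>c\<in>UNIV. 1 * (dist \<mu> \<nu> * \<bar>ln (\<nu> $ k $ c)\<bar>))"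
    unfolding abs_mult using assms by (intro sum_mono mult_mono entry) auto
  finally show ?thesis by (simp add: sum_distrib_left)
qed

section \<open>Limits of the block proportions and polynomial factors\<close>

lemma block_fraction_tendsto:
  "limiting_proportions S \<gamma> \<Longrightarrow> (\<lambda>N. block_fraction S N k) \<longlonglongrightarrow> \<gamma> k"
  by (simp add: limiting_proportions_def block_fraction_def)

lemma eventually_cross_uniform:
  assumes "limiting_proportions S \<gamma>" "0 < \<epsilon>"
  shows "\<forall>\<^sub>F N in sequentially. \<forall>\<mu> \<in> (prob_rows :: (real^'q::finite^'s::finite) set).
     \<bar>cross (block_fraction S N) \<mu> \<mu> - cross \<gamma> \<mu> \<mu>\<bar> < \<epsilon>"
proof -
  have "(\<lambda>N. real CARD('q) * (\<Sum>k\<in>UNIV. \<bar>block_fraction S N k - \<gamma> k\<bar>))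
      \<longlonglongrightarrow> real CARD('q) * (\<Sum>k\<in>UNIV. \<bar>\<gamma> k - \<gamma> k\<bar>)"
    by (intro tendsto_intros block_fraction_tendsto assms)
  then have "(\<lambda>N. real CARD('q) * (\<Sum>k\<in>UNIV. \<bar>block_fraction S N k - \<gamma> k\<bar>)) \<longlonglongrightarrow> 0" by simp
  from order_tendstoD(2)[OF this assms(2)] show ?thesis
    by eventually_elim (use cross_self_weight_diff in \<open>blast intro: le_less_trans\<close>)
qed

lemma eventually_energy_uniform:
  assumes "limiting_proportions S \<gamma>" "0 < \<epsilon>"
  shows "\<forall>\<^sub>F N in sequentially. \<forall>\<mu> \<in> (prob_rows :: (real^'q::finite^'s::finite) set).
     \<bar>energy (block_fraction S N) \<alpha> \<beta> \<mu> - energy \<gamma> \<alpha> \<beta> \<mu>\<bar> < \<epsilon>"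
proof -
  let ?b = "\<lambda>g h. \<Sum>k\<in>UNIV. \<Sum>k'\<in>UNIV. \<bar>if k = k' then \<beta> else \<alpha>\<bar> * \<bar>g k * g k' - h k * h k'\<bar> * real CARD('q)"
  have "(\<lambda>N. ?b (block_fraction S N) \<gamma>) \<longlonglongrightarrow> ?b \<gamma> \<gamma>"
    by (intro tendsto_intros block_fraction_tendsto assms)
  then have "(\<lambda>N. ?b (block_fraction S N) \<gamma>) \<longlonglongrightarrow> 0" by simp
  from order_tendstoD(2)[OF this assms(2)] show ?thesis
    by eventually_elim (use energy_weight_diff in \<open>blast intro: le_less_trans\<close>)
qed

lemma eventually_block_fraction_ge:
  fixes S :: "nat \<Rightarrow> 's::finite \<Rightarrow> nat set"
  assumes "limiting_proportions S \<gamma>"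
  obtains g where "g > 0" "\<forall>\<^sub>F N in sequentially. \<forall>k. g \<le> block_fraction S N k"
proof
  \<comment> \<open>Half of the smallest limit is strictly below every \<open>\<gamma> k\<close>,
    and there are finitely many blocks, so one threshold for \<open>N\<close> works for all of
    them.\<close>
  define g where "g = Min (range \<gamma>) / 2"
  have "Min (range \<gamma>) \<in> range \<gamma>" by (intro Min_in) auto
  then have pos: "Min (range \<gamma>) > 0" using assms by (auto simp: limiting_proportions_def)
  then show "g > 0" by (simp add: g_def)
  have "\<forall>\<^sub>F N in sequentially. g < block_fraction S N k" for k
  proof (rule order_tendstoD(1)[OF block_fraction_tendsto[OF assms]])
    have "Min (range \<gamma>) \<le> \<gamma> k" by simp
    then show "g < \<gamma> k" using pos unfolding g_def by linarith
  qed
  then show "\<forall>\<^sub>F N in sequentially. \<forall>k. g \<le> block_fraction S N k"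
    by (intro eventually_all_finite) (metis (mono_tags, lifting) eventually_mono less_imp_le)
qed

lemma eventually_blocks_nonempty:
  fixes S :: "nat \<Rightarrow> 's::finite \<Rightarrow> nat set"
  assumes "limiting_proportions S \<gamma>"
  shows "\<forall>\<^sub>F N in sequentially. \<forall>k. S N k \<noteq> {}"
proof -
  obtain g where g: "g > 0" "\<forall>\<^sub>F N in sequentially. \<forall>k. g \<le> block_fraction S N k"
    by (rule eventually_block_fraction_ge[OF assms])
  from g(2) show ?thesis
  proof eventually_elim
    case (elim N)
    show ?case
    proof
      fix k show "S N k \<noteq> {}" using elim[rule_format, of k] g(1) by (auto simp: block_fraction_def)
    qed
  qed
qed

lemma eventually_power_le_exp:
  assumes "0 < \<epsilon>"
  shows "\<forall>\<^sub>F N in sequentially. real ((N + 1) ^ d) \<le> exp (real N * \<epsilon>)"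
proof -
  have "(\<lambda>N. real d * ln (real N + 1) / real N) \<longlonglongrightarrow> 0" by real_asymp
  from order_tendstoD(2)[OF this assms] eventually_gt_at_top[of 0] show ?thesis
  proof eventually_elim
    case (elim N)
    then have "real d * ln (real N + 1) \<le> real N * \<epsilon>" by (simp add: field_simps)
    then have "exp (real d * ln (real N + 1)) \<le> exp (real N * \<epsilon>)" by simp
    then show ?case by (simp add: exp_of_nat_mult add.commute)
  qed
qed

section \<open>Lower bound for the number of configurations near a given matrix\<close>

text \<open>A law of large numbers for the product measure, followed by dividing mass by weight. The
  count is over a ball because a given \<open>\<nu>\<close> may fail to be a value of
  \<open>M_N\<close> at any \<open>N\<close>.\<close>

lemma eventually_card_near_ge:
  fixes S :: "nat \<Rightarrow> 's::finite \<Rightarrow> nat set" and \<nu> :: "real^'q::finite^'s"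
  assumes S: "block_partition S" and \<gamma>: "limiting_proportions S \<gamma>"
    and \<nu>: "\<nu> \<in> prob_rows" and \<delta>: "0 < \<delta>" and \<epsilon>: "0 < \<epsilon>"
  shows "\<forall>\<^sub>F N in sequentially.
    exp (real N * (- cross \<gamma> \<nu> \<nu> - \<epsilon>)) \<le> real (card {\<omega>\<in>configs N. dist (order_parameter S N \<omega>) \<nu> < \<delta>})"
proof -
  define C where "C = (\<Sum>k\<in>UNIV. \<Sum>c\<in>UNIV. \<bar>ln (\<nu> $ k $ c)\<bar>)"
  \<comment> \<open>Within distance \<open>r\<close> the cross entropy moves by at most
    \<open>\<epsilon> / 4\<close>; the summand 1 avoids division by zero when
    \<open>C = 0\<close>.\<close>
  define r where "r = min \<delta> (\<epsilon> / 4 / (1 + C))"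
  have C: "0 \<le> C" unfolding C_def by (intro sum_nonneg) auto
  have r: "0 < r" "r \<le> \<delta>" using C \<delta> \<epsilon> by (auto simp: r_def)
  have rC: "r * C \<le> \<epsilon> / 4"
  proof -
    have "r * C \<le> \<epsilon> / 4 / (1 + C) * (1 + C)"
      using C \<epsilon> by (intro mult_mono) (auto simp: r_def)
    also have "\<dots> = \<epsilon> / 4" using C by (intro nonzero_eq_divide_eq[THEN iffD1, OF _ refl]) simp
    finally show ?thesis .
  qed
  obtain g where g: "g > 0" "\<forall>\<^sub>F N in sequentially. \<forall>k. g \<le> block_fraction S N k"
    by (rule eventually_block_fraction_ge[OF \<gamma>])
  \<comment> \<open>A type at distance at least \<open>r\<close> costs
    \<open>g * r\<^sup>2 / 4 = 2 * a\<close> in the exponent. One \<open>a\<close> absorbs the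
    polynomial number of types, and the other makes the far mass at most one half.\<close>
  define a where "a = g * r\<^sup>2 / 8"
  have a: "0 < a" using g(1) r(1) by (simp add: a_def)
  have half: "\<forall>\<^sub>F N in sequentially. exp (- real N * b) \<le> 1/2" if "0 < b" for b
  proof -
    have "(\<lambda>N. exp (- real N * b)) \<longlonglongrightarrow> 0" using that by real_asymp
    from order_tendstoD(2)[OF this, of "1/2"] show ?thesis by (auto elim: eventually_mono)
  qed
  have "\<epsilon> / 4 > 0" using \<epsilon> by simp
  from half[OF a] half[OF this] eventually_power_le_exp[OF a, of "CARD('s) * CARD('q)"]
    eventually_cross_uniform[OF \<gamma> this, where 'q='q] g(2)
    eventually_blocks_nonempty[OF \<gamma>] eventually_gt_at_top[of 0]
  show ?thesis
  proof eventually_elim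
    case (elim N)
    let ?M = "order_parameter S N :: _ \<Rightarrow> real^'q^'s"
    let ?b = "block_fraction S N"
    have N: "N > 0" by (rule elim)
    have ne: "S N k \<noteq> {}" for k using elim by blast
    have MP: "?M \<omega> \<in> prob_rows" for \<omega> by (rule order_parameter_prob_rows[OF S ne])
    define far where "far = {\<omega>\<in>configs N. tilt S N \<nu> \<omega> \<noteq> 0 \<and> r \<le> dist (?M \<omega>) \<nu>}"
    define near where "near = {\<omega>\<in>configs N. tilt S N \<nu> \<omega> \<noteq> 0 \<and> dist (?M \<omega>) \<nu> < r}"
    have "(\<Sum>\<omega>\<in>far. tilt S N \<nu> \<omega>) = (\<Sum>\<omega>\<in>far. exp (real N * cross ?b (?M \<omega>) \<nu>))"
      by (intro sum.cong refl tilt_eq_exp_cross[OF S N \<nu>]) (auto simp: far_def)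
    also have "\<dots> \<le> real ((N + 1) ^ (CARD('s) * CARD('q))) * exp (real N * (- (2 * a)))"
    proof (rule type_sum_le[OF S N ne])
      fix \<omega> assume w: "\<omega> \<in> far"
      have "cross ?b (?M \<omega>) \<nu> - cross ?b (?M \<omega>) (?M \<omega>) \<le> - g * (dist (?M \<omega>) \<nu>)\<^sup>2 / 4"
        using w g(1) elim by (intro cross_diff_le MP \<nu>) (auto simp: far_def tilt_support[OF S])
      also have "\<dots> \<le> - g * r\<^sup>2 / 4"
        using w g(1) r(1) power_mono[of r "dist (?M \<omega>) \<nu>" 2] by (simp add: far_def)
      finally show "cross ?b (?M \<omega>) \<nu> - cross ?b (?M \<omega>) (?M \<omega>) \<le> - (2 * a)"
        by (simp add: a_def)
    qed (auto simp: far_def)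
    also have "\<dots> \<le> exp (real N * a) * exp (real N * (- (2 * a)))"
      by (intro mult_right_mono elim) auto
    also have "\<dots> = exp (- real N * a)" by (simp add: exp_add[symmetric])
    also have "\<dots> \<le> 1/2" by (rule elim)
    finally have far_le: "(\<Sum>\<omega>\<in>far. tilt S N \<nu> \<omega>) \<le> 1/2" .
    have "1 = (\<Sum>\<omega>\<in>configs N. tilt S N \<nu> \<omega>)" by (rule sum_tilt[OF S \<nu>, symmetric])
    also have "\<dots> = (\<Sum>\<omega>\<in>far \<union> near. tilt S N \<nu> \<omega>)"
      by (intro sum.mono_neutral_right) (auto simp: far_def near_def)
    also have "\<dots> = (\<Sum>\<omega>\<in>far. tilt S N \<nu> \<omega>) + (\<Sum>\<omega>\<in>near. tilt S N \<nu> \<omega>)"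
      by (intro sum.union_disjoint) (auto simp: far_def near_def)
    finally have "1/2 \<le> (\<Sum>\<omega>\<in>near. tilt S N \<nu> \<omega>)" using far_le by simp
    also have "\<dots> \<le> (\<Sum>\<omega>\<in>near. exp (real N * (cross \<gamma> \<nu> \<nu> + \<epsilon> / 2)))"
    proof (rule sum_mono)
      fix \<omega> assume w: "\<omega> \<in> near"
      have "\<bar>cross ?b (?M \<omega>) \<nu> - cross ?b \<nu> \<nu>\<bar> \<le> dist (?M \<omega>) \<nu> * C"
        unfolding C_def by (intro cross_near_diff block_fraction_bounds[OF S])
      also have "\<dots> \<le> r * C" using w C by (intro mult_right_mono) (auto simp: near_def)
      finally have "cross ?b (?M \<omega>) \<nu> \<le> cross ?b \<nu> \<nu> + \<epsilon> / 4" using rC by linarith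
      moreover have "cross ?b \<nu> \<nu> \<le> cross \<gamma> \<nu> \<nu> + \<epsilon> / 4" using elim(4)[rule_format, OF \<nu>] by linarith
      ultimately have "cross ?b (?M \<omega>) \<nu> \<le> cross \<gamma> \<nu> \<nu> + \<epsilon> / 2" by simp
      then show "tilt S N \<nu> \<omega> \<le> exp (real N * (cross \<gamma> \<nu> \<nu> + \<epsilon> / 2))"
        using w by (subst tilt_eq_exp_cross[OF S N \<nu>]) (auto simp: near_def mult_left_mono)
    qed
    also have "\<dots> = real (card near) * exp (real N * (cross \<gamma> \<nu> \<nu> + \<epsilon> / 2))" by simp
    also have "\<dots> \<le> real (card {\<omega>\<in>configs N. dist (?M \<omega>) \<nu> < \<delta>}) * exp (real N * (cross \<gamma> \<nu> \<nu> + \<epsilon> / 2))"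
      using r(2) by (intro mult_right_mono of_nat_mono card_mono) (auto simp: near_def)
    \<comment> \<open>The constant one half is traded for \<open>exp (- N * \<epsilon> / 4)\<close>.
      Together with the \<open>\<epsilon> / 2\<close> lost in the weights, the exponent stays within
      \<open>\<epsilon>\<close>.\<close>
    finally have "exp (- real N * (\<epsilon> / 4)) \<le>
        real (card {\<omega>\<in>configs N. dist (?M \<omega>) \<nu> < \<delta>}) * exp (real N * (cross \<gamma> \<nu> \<nu> + \<epsilon> / 2))"
      using elim(2) by linarith
    then have "exp (- real N * (\<epsilon> / 4)) * exp (- (real N * (cross \<gamma> \<nu> \<nu> + \<epsilon> / 2))) \<le>
        real (card {\<omega>\<in>configs N. dist (?M \<omega>) \<nu> < \<delta>})"
      by (simp add: exp_minus field_simps)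
    moreover have "exp (real N * (- cross \<gamma> \<nu> \<nu> - \<epsilon>)) \<le> exp (- real N * (\<epsilon> / 4)) * exp (- (real N * (cross \<gamma> \<nu> \<nu> + \<epsilon> / 2)))"
      using \<epsilon> by (simp add: exp_add[symmetric] algebra_simps)
    ultimately show ?case by linarith
  qed
qed

section \<open>Exponential asymptotics of Boltzmann sums\<close>

text \<open>An unnormalised Gibbs mass; \<open>B = UNIV\<close> gives the partition function, so the
  same two estimates control numerator and denominator of a Gibbs probability.\<close>

definition boltzmann_sum ::
  "(nat \<Rightarrow> 's::finite \<Rightarrow> nat set) \<Rightarrow> real \<Rightarrow> real \<Rightarrow> nat \<Rightarrow> (real^'q::finite^'s) set \<Rightarrow> real" where
  "boltzmann_sum S \<alpha> \<beta> N B =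
     (\<Sum>\<omega>\<in>{\<omega>\<in>configs N. order_parameter S N \<omega> \<in> B}. exp (- hamiltonian S \<alpha> \<beta> N \<omega>))"

text \<open>The functional of the rate function without its constant \<open>ln q\<close>, which
  cancels against the same constant in the supremum.\<close>

definition free_functional :: "('s::finite \<Rightarrow> real) \<Rightarrow> real \<Rightarrow> real \<Rightarrow> real^'q::finite^'s \<Rightarrow> real" where
  "free_functional \<gamma> \<alpha> \<beta> \<mu> = energy \<gamma> \<alpha> \<beta> \<mu> - cross \<gamma> \<mu> \<mu>"

lemma continuous_on_free_functional: "continuous_on prob_rows (free_functional \<gamma> \<alpha> \<beta>)"
  unfolding free_functional_def
  by (intro continuous_on_diff continuous_on_cross continuous_on_energy)

text \<open>One third of \<open>\<epsilon>\<close> each pays for the number of types, for the energy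
  and for the entropy at finite \<open>N\<close>. If \<open>B\<close> misses
  \<open>prob_rows\<close>, then \<open>L\<close> is arbitrary, which accounts for the infinite
  values of the rate.\<close>

lemma boltzmann_sum_upper:
  fixes S :: "nat \<Rightarrow> 's::finite \<Rightarrow> nat set" and B :: "(real^'q::finite^'s) set"
  assumes S: "block_partition S" and \<gamma>: "limiting_proportions S \<gamma>"
    and L: "\<And>\<mu>. \<mu> \<in> B \<Longrightarrow> \<mu> \<in> prob_rows \<Longrightarrow> free_functional \<gamma> \<alpha> \<beta> \<mu> \<le> L" and \<epsilon>: "0 < \<epsilon>"
  shows "\<forall>\<^sub>F N in sequentially. boltzmann_sum S \<alpha> \<beta> N B \<le> exp (real N * (L + \<epsilon>))"
proof -
  have e3: "\<epsilon> / 3 > 0" using \<epsilon> by simp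
  from eventually_power_le_exp[OF e3, of "CARD('s) * CARD('q)"]
    eventually_cross_uniform[OF \<gamma> e3, where 'q='q] eventually_energy_uniform[OF \<gamma> e3, where 'q='q and \<alpha>=\<alpha> and \<beta>=\<beta>]
    eventually_blocks_nonempty[OF \<gamma>] eventually_gt_at_top[of 0]
  show ?thesis
  proof eventually_elim
    case (elim N)
    let ?M = "order_parameter S N :: _ \<Rightarrow> real^'q^'s"
    have N: "N > 0" by (rule elim)
    have ne: "S N k \<noteq> {}" for k using elim by blast
    have MP: "?M \<omega> \<in> prob_rows" for \<omega> by (rule order_parameter_prob_rows[OF S ne])
    have "boltzmann_sum S \<alpha> \<beta> N B
      = (\<Sum>\<omega>\<in>{\<omega>\<in>configs N. ?M \<omega> \<in> B}. exp (real N * energy (block_fraction S N) \<alpha> \<beta> (?M \<omega>)))"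
      by (simp add: boltzmann_sum_def hamiltonian_energy[OF S N])
    also have "\<dots> \<le> real ((N + 1) ^ (CARD('s) * CARD('q))) * exp (real N * (L + 2 * (\<epsilon> / 3)))"
    proof (rule type_sum_le[OF S N ne])
      fix \<omega> assume "\<omega> \<in> {\<omega>\<in>configs N. ?M \<omega> \<in> B}"
      then have "free_functional \<gamma> \<alpha> \<beta> (?M \<omega>) \<le> L" using L MP by auto
      moreover have "energy (block_fraction S N) \<alpha> \<beta> (?M \<omega>) < energy \<gamma> \<alpha> \<beta> (?M \<omega>) + \<epsilon> / 3"
        using elim(3)[rule_format, OF MP[of \<omega>]] by linarith
      moreover have "cross (block_fraction S N) (?M \<omega>) (?M \<omega>) > cross \<gamma> (?M \<omega>) (?M \<omega>) - \<epsilon> / 3"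
        using elim(2)[rule_format, OF MP[of \<omega>]] by linarith
      ultimately show "energy (block_fraction S N) \<alpha> \<beta> (?M \<omega>) - cross (block_fraction S N) (?M \<omega>) (?M \<omega>)
         \<le> L + 2 * (\<epsilon> / 3)" by (simp add: free_functional_def)
    qed auto
    also have "\<dots> \<le> exp (real N * (\<epsilon> / 3)) * exp (real N * (L + 2 * (\<epsilon> / 3)))"
      by (intro mult_right_mono elim) auto
    also have "\<dots> = exp (real N * (L + \<epsilon>))"
      by (simp add: exp_add[symmetric] algebra_simps)
    finally show ?case .
  qed
qed

text \<open>Only configurations in a small ball around \<open>\<nu>\<close> inside \<open>B\<close>
  are kept. There the Boltzmann weight is nearly constant by continuity of the energy, and their
  number is already bounded below.\<close>

lemma boltzmann_sum_lower:
  fixes S :: "nat \<Rightarrow> 's::finite \<Rightarrow> nat set" and B :: "(real^'q::finite^'s) set"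
  assumes S: "block_partition S" and \<gamma>: "limiting_proportions S \<gamma>"
    and \<nu>: "\<nu> \<in> prob_rows" "\<nu> \<in> interior B" and \<epsilon>: "0 < \<epsilon>"
  shows "\<forall>\<^sub>F N in sequentially. exp (real N * (free_functional \<gamma> \<alpha> \<beta> \<nu> - \<epsilon>)) \<le> boltzmann_sum S \<alpha> \<beta> N B"
proof -
  have e3: "\<epsilon> / 3 > 0" using \<epsilon> by simp
  obtain \<delta>1 where d1: "\<delta>1 > 0" "ball \<nu> \<delta>1 \<subseteq> B" using \<nu>(2) by (auto simp: mem_interior)
  obtain \<delta>2 where d2: "\<delta>2 > 0" "\<And>\<mu>. dist \<mu> \<nu> < \<delta>2 \<Longrightarrow> dist (energy \<gamma> \<alpha> \<beta> \<mu>) (energy \<gamma> \<alpha> \<beta> \<nu>) < \<epsilon> / 3"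
    using continuous_on_energy[of "UNIV :: (real^'q^'s) set" \<gamma> \<alpha> \<beta>] e3 unfolding continuous_on_iff by (metis UNIV_I)
  define \<delta> where "\<delta> = min \<delta>1 \<delta>2"
  have \<delta>: "\<delta> > 0" using d1 d2 by (simp add: \<delta>_def)
  from eventually_card_near_ge[OF S \<gamma> \<nu>(1) \<delta> e3] eventually_energy_uniform[OF \<gamma> e3, where 'q='q and \<alpha>=\<alpha> and \<beta>=\<beta>]
    eventually_blocks_nonempty[OF \<gamma>] eventually_gt_at_top[of 0]
  show ?thesis
  proof eventually_elim
    case (elim N)
    let ?M = "order_parameter S N :: _ \<Rightarrow> real^'q^'s"
    have N: "N > 0" by (rule elim)
    have ne: "S N k \<noteq> {}" for k using elim by blast
    have MP: "?M \<omega> \<in> prob_rows" for \<omega> by (rule order_parameter_prob_rows[OF S ne])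
    let ?near = "{\<omega>\<in>configs N. dist (?M \<omega>) \<nu> < \<delta>}"
    have "exp (real N * (free_functional \<gamma> \<alpha> \<beta> \<nu> - \<epsilon>))
       = exp (real N * (- cross \<gamma> \<nu> \<nu> - \<epsilon> / 3)) * exp (real N * (energy \<gamma> \<alpha> \<beta> \<nu> - 2 * (\<epsilon> / 3)))"
      by (simp add: exp_add[symmetric] algebra_simps free_functional_def)
    also have "\<dots> \<le> real (card ?near) * exp (real N * (energy \<gamma> \<alpha> \<beta> \<nu> - 2 * (\<epsilon> / 3)))"
      by (intro mult_right_mono elim) auto
    also have "\<dots> = (\<Sum>\<omega>\<in>?near. exp (real N * (energy \<gamma> \<alpha> \<beta> \<nu> - 2 * (\<epsilon> / 3))))" by simp
    also have "\<dots> \<le> (\<Sum>\<omega>\<in>?near. exp (- hamiltonian S \<alpha> \<beta> N \<omega>))"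
    proof (rule sum_mono)
      fix \<omega> assume "\<omega> \<in> ?near"
      then have "dist (energy \<gamma> \<alpha> \<beta> (?M \<omega>)) (energy \<gamma> \<alpha> \<beta> \<nu>) < \<epsilon> / 3"
        by (intro d2) (auto simp: \<delta>_def)
      then have "energy \<gamma> \<alpha> \<beta> (?M \<omega>) > energy \<gamma> \<alpha> \<beta> \<nu> - \<epsilon> / 3" unfolding dist_real_def by linarith
      moreover have "energy (block_fraction S N) \<alpha> \<beta> (?M \<omega>) > energy \<gamma> \<alpha> \<beta> (?M \<omega>) - \<epsilon> / 3"
        using elim(2)[rule_format, OF MP[of \<omega>]] by linarith
      ultimately show "exp (real N * (energy \<gamma> \<alpha> \<beta> \<nu> - 2 * (\<epsilon> / 3))) \<le> exp (- hamiltonian S \<alpha> \<beta> N \<omega>)"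
        unfolding hamiltonian_energy[OF S N] by (simp add: mult_left_mono)
    qed
    also have "\<dots> \<le> boltzmann_sum S \<alpha> \<beta> N B"
      unfolding boltzmann_sum_def
    proof (rule sum_mono2)
      show "?near \<subseteq> {\<omega>\<in>configs N. ?M \<omega> \<in> B}"
        using d1(2) by (auto simp: \<delta>_def subset_iff mem_ball dist_commute)
    qed auto
    finally show ?case .
  qed
qed

section \<open>The rate function\<close>

lemma half_form_wrt_eq_energy:
  fixes \<mu> :: "real^'q::finite^'s::finite"
  shows "1/2 * form_wrt (interaction_matrix \<alpha> \<beta>) (diag_matrix \<gamma> ** \<mu>) (diag_matrix \<gamma> ** \<mu>) = energy \<gamma> \<alpha> \<beta> \<mu>"
proof -
  have entry: "(diag_matrix \<gamma> ** \<mu>) $ k $ c = \<gamma> k * \<mu> $ k $ c" for k c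
  proof -
    have "(diag_matrix \<gamma> ** \<mu>) $ k $ c = (\<Sum>j\<in>UNIV. (if k = j then \<gamma> k else 0) * \<mu> $ j $ c)"
      by (simp add: matrix_matrix_mult_def diag_matrix_def)
    also have "\<dots> = (\<Sum>j\<in>UNIV. if k = j then \<gamma> k * \<mu> $ j $ c else 0)"
      by (intro sum.cong) auto
    finally show ?thesis by simp
  qed
  have "form_wrt (interaction_matrix \<alpha> \<beta>) (diag_matrix \<gamma> ** \<mu>) (diag_matrix \<gamma> ** \<mu>) =
    (\<Sum>c\<in>UNIV. \<Sum>k'\<in>UNIV. (\<Sum>k\<in>UNIV. (diag_matrix \<gamma> ** \<mu>) $ k $ c * interaction_matrix \<alpha> \<beta> $ k $ k')
       * (diag_matrix \<gamma> ** \<mu>) $ k' $ c)"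
    unfolding form_wrt_def trace_def by (simp add: matrix_matrix_mult_def transpose_def)
  also have "\<dots> = (\<Sum>c\<in>UNIV. \<Sum>k'\<in>UNIV. \<Sum>k\<in>UNIV. (if k = k' then \<beta> else \<alpha>) * (\<gamma> k * \<gamma> k') * (\<mu> $ k $ c * \<mu> $ k' $ c))"
    unfolding entry by (simp add: interaction_matrix_def sum_distrib_left mult_ac)
  also have "\<dots> = (\<Sum>k\<in>UNIV. \<Sum>k'\<in>UNIV. \<Sum>c\<in>UNIV. (if k = k' then \<beta> else \<alpha>) * (\<gamma> k * \<gamma> k') * (\<mu> $ k $ c * \<mu> $ k' $ c))"
    by (subst sum.swap, subst (2) sum.swap, subst sum.swap) (rule refl)
  finally show ?thesis by (simp add: energy_def sum_distrib_left)
qed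

text \<open>Each double sum over blocks is split into its diagonal, with coefficient
  \<open>\<beta>\<close>, and the ordered pairs of distinct blocks, with coefficient
  \<open>\<alpha>\<close>.\<close>

lemma explicit_functional_eq:
  fixes \<mu> :: "real^'q::finite^'s::finite"
  shows "explicit_functional \<gamma> \<alpha> \<beta> \<mu> = free_functional \<gamma> \<alpha> \<beta> \<mu> - ln (real CARD('q))"
proof -
  let ?t = "\<lambda>c k k'. \<gamma> k * \<gamma> k' * \<mu> $ k $ c * \<mu> $ k' $ c"
  have "(\<Sum>k\<in>UNIV. \<Sum>k'\<in>UNIV. (if k = k' then \<beta> else \<alpha>) * ?t c k k')
    = \<beta> * (\<Sum>k\<in>UNIV. (\<gamma> k)\<^sup>2 * (\<mu> $ k $ c)\<^sup>2) + \<alpha> * (\<Sum>(k, k')\<in>{(k, k'). k \<noteq> k'}. ?t c k k')" for c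
  proof -
    have "{(k, k'). k \<noteq> k'} = {x \<in> UNIV \<times> UNIV. fst x \<noteq> (snd x :: 's)}" by auto
    then have off: "(\<Sum>(k, k')\<in>{(k, k'). k \<noteq> k'}. ?t c k k') = (\<Sum>k\<in>UNIV. \<Sum>k'\<in>UNIV. if k \<noteq> k' then ?t c k k' else 0)"
      by (simp only: sum.inter_filter finite_cartesian_product finite sum.cartesian_product case_prod_unfold)
    have "(\<Sum>k'\<in>UNIV. (if k = k' then \<beta> else \<alpha>) * ?t c k k')
      = \<beta> * ((\<gamma> k)\<^sup>2 * (\<mu> $ k $ c)\<^sup>2) + \<alpha> * (\<Sum>k'\<in>UNIV. if k \<noteq> k' then ?t c k k' else 0)" for k
    proof -
      have "(\<Sum>k'\<in>UNIV. (if k = k' then \<beta> else \<alpha>) * ?t c k k')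
        = (\<Sum>k'\<in>UNIV. (if k = k' then \<beta> * ?t c k k' else 0) + \<alpha> * (if k \<noteq> k' then ?t c k k' else 0))"
        by (intro sum.cong) auto
      then show ?thesis
        by (simp add: sum.distrib sum_distrib_left power2_eq_square mult_ac)
    qed
    then show ?thesis unfolding off by (simp add: sum.distrib sum_distrib_left)
  qed
  note row = this
  have "energy \<gamma> \<alpha> \<beta> \<mu> = 1/2 * (\<Sum>c\<in>UNIV. \<Sum>k\<in>UNIV. \<Sum>k'\<in>UNIV. (if k = k' then \<beta> else \<alpha>) * ?t c k k')"
  proof -
    have "(\<Sum>k\<in>UNIV. \<Sum>k'\<in>UNIV. (if k = k' then \<beta> else \<alpha>) * (\<gamma> k * \<gamma> k') * (\<Sum>c\<in>UNIV. \<mu> $ k $ c * \<mu> $ k' $ c))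
      = (\<Sum>k\<in>UNIV. \<Sum>k'\<in>UNIV. \<Sum>c\<in>UNIV. (if k = k' then \<beta> else \<alpha>) * ?t c k k')"
      by (simp add: sum_distrib_left mult_ac)
    also have "\<dots> = (\<Sum>k\<in>UNIV. \<Sum>c\<in>UNIV. \<Sum>k'\<in>UNIV. (if k = k' then \<beta> else \<alpha>) * ?t c k k')"
      by (intro sum.cong refl sum.swap)
    also have "\<dots> = (\<Sum>c\<in>UNIV. \<Sum>k\<in>UNIV. \<Sum>k'\<in>UNIV. (if k = k' then \<beta> else \<alpha>) * ?t c k k')"
      by (rule sum.swap)
    finally show ?thesis unfolding energy_def by simp
  qed
  then show ?thesis
    unfolding row explicit_functional_def free_functional_def entropy_rate_def cross_def
    by (simp add: sum.distrib sum_distrib_left[symmetric] algebra_simps)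
qed

lemma potts_rate_explicit:
  fixes \<nu> :: "real^'q::finite^'s::finite"
  assumes "\<nu> \<in> prob_rows"
  shows "potts_rate \<gamma> \<alpha> \<beta> \<nu> = - ereal (explicit_functional \<gamma> \<alpha> \<beta> \<nu>)
     + (SUP \<mu>\<in>(prob_rows :: (real^'q^'s) set). ereal (explicit_functional \<gamma> \<alpha> \<beta> \<mu>))"
proof -
  have "energy \<gamma> \<alpha> \<beta> \<mu> - entropy_rate \<gamma> \<mu> = explicit_functional \<gamma> \<alpha> \<beta> \<mu>" for \<mu> :: "real^'q^'s"
    by (simp add: explicit_functional_eq free_functional_def entropy_rate_def cross_def)
  then show ?thesis
    using assms unfolding potts_rate_def Let_def half_form_wrt_eq_energy by simp
qed

text \<open>By compactness the supremum is attained, so it is a real number and the rate is a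
  difference of reals on \<open>prob_rows\<close>.\<close>

lemma potts_rate_eq:
  obtains m where "m \<in> (prob_rows :: (real^'q::finite^'s::finite) set)"
    "\<And>\<mu>::real^'q^'s. \<mu> \<in> prob_rows \<Longrightarrow> free_functional \<gamma> \<alpha> \<beta> \<mu> \<le> free_functional \<gamma> \<alpha> \<beta> m"
    "\<And>\<nu>::real^'q^'s. potts_rate \<gamma> \<alpha> \<beta> \<nu> = (if \<nu> \<in> prob_rows then
        ereal (free_functional \<gamma> \<alpha> \<beta> m - free_functional \<gamma> \<alpha> \<beta> \<nu>) else \<infinity>)"
proof -
  have "\<exists>m\<in>prob_rows. \<forall>\<mu>\<in>(prob_rows :: (real^'q^'s) set). free_functional \<gamma> \<alpha> \<beta> \<mu> \<le> free_functional \<gamma> \<alpha> \<beta> (m :: real^'q^'s)"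
    by (rule continuous_attains_sup[OF compact_prob_rows prob_rows_nonempty continuous_on_free_functional])
  then obtain m :: "real^'q^'s" where m: "m \<in> prob_rows"
      "\<And>\<mu>::real^'q^'s. \<mu> \<in> prob_rows \<Longrightarrow> free_functional \<gamma> \<alpha> \<beta> \<mu> \<le> free_functional \<gamma> \<alpha> \<beta> m"
    by blast
  have "(SUP \<mu>\<in>(prob_rows :: (real^'q^'s) set). ereal (explicit_functional \<gamma> \<alpha> \<beta> \<mu>))
     = ereal (explicit_functional \<gamma> \<alpha> \<beta> m)"
    using m by (intro antisym SUP_least SUP_upper) (auto simp: explicit_functional_eq)
  then have "potts_rate \<gamma> \<alpha> \<beta> \<nu> = (if \<nu> \<in> prob_rows then
        ereal (free_functional \<gamma> \<alpha> \<beta> m - free_functional \<gamma> \<alpha> \<beta> \<nu>) else \<infinity>)" for \<nu> :: "real^'q^'s"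
    by (cases "\<nu> \<in> prob_rows") (simp add: potts_rate_explicit explicit_functional_eq, simp add: potts_rate_def)
  with m that show thesis by blast
qed

text \<open>A level set is a closed subset of the compact set \<open>prob_rows\<close>. Closedness
  of the level sets then gives lower semicontinuity.\<close>

lemma rate_function_potts_rate:
  "rate_function (potts_rate \<gamma> \<alpha> \<beta> :: real^'q::finite^'s::finite \<Rightarrow> ereal)"
proof -
  obtain m where m: "m \<in> (prob_rows :: (real^'q^'s) set)"
    "\<And>\<mu>::real^'q^'s. \<mu> \<in> prob_rows \<Longrightarrow> free_functional \<gamma> \<alpha> \<beta> \<mu> \<le> free_functional \<gamma> \<alpha> \<beta> m"
    "\<And>\<nu>::real^'q^'s. potts_rate \<gamma> \<alpha> \<beta> \<nu> = (if \<nu> \<in> prob_rows then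
        ereal (free_functional \<gamma> \<alpha> \<beta> m - free_functional \<gamma> \<alpha> \<beta> \<nu>) else \<infinity>)"
    using potts_rate_eq by blast
  let ?J = "potts_rate \<gamma> \<alpha> \<beta> :: real^'q^'s \<Rightarrow> ereal"
  have nonneg: "0 \<le> ?J x" for x using m(2)[of x] by (simp add: m(3))
  have compact: "compact {x. ?J x \<le> ereal L}" for L
  proof -
    let ?C = "prob_rows \<inter> free_functional \<gamma> \<alpha> \<beta> -` {free_functional \<gamma> \<alpha> \<beta> m - L..}"
    have "closed ?C"
      by (intro continuous_closed_preimage continuous_on_free_functional compact_imp_closed
          compact_prob_rows closed_atLeast)
    then have "compact (prob_rows \<inter> ?C)" by (rule compact_Int_closed[OF compact_prob_rows])
    moreover have "{x. ?J x \<le> ereal L} = prob_rows \<inter> ?C" using m(3) by auto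
    ultimately show ?thesis by (simp only:)
  qed
  have "open {x. a < ?J x}" for a
  proof (cases a)
    case (real L)
    have "{x. a < ?J x} = - {x. ?J x \<le> ereal L}" using real by auto
    then show ?thesis using compact_imp_closed[OF compact] by (simp add: open_Compl)
  next
    case PInf
    then show ?thesis by simp
  next
    case MInf
    then have "a < ?J x" for x using nonneg[of x] by (auto intro: less_le_trans[of _ 0])
    then show ?thesis by simp
  qed
  then show ?thesis using nonneg compact unfolding rate_function_def by blast
qed

section \<open>The large deviation principle\<close>

lemma boltzmann_sum_UNIV_pos: "boltzmann_sum S \<alpha> \<beta> N (UNIV :: (real^'q::finite^'s::finite) set) > 0"
  unfolding boltzmann_sum_def by (intro sum_pos) auto

lemma gibbs_measure_eq:
  fixes S :: "nat \<Rightarrow> 's::finite \<Rightarrow> nat set"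
  shows "(gibbs_measure S \<alpha> \<beta> N :: (nat \<Rightarrow> 'q::finite) measure) =
    point_measure (configs N) (\<lambda>\<omega>. ennreal (exp (- hamiltonian S \<alpha> \<beta> N \<omega>) / boltzmann_sum S \<alpha> \<beta> N (UNIV :: (real^'q^'s) set)))"
  by (simp add: gibbs_measure_def boltzmann_sum_def)

lemma prob_space_gibbs_measure: "prob_space (gibbs_measure S \<alpha> \<beta> N :: (nat \<Rightarrow> 'q::finite) measure)"
proof
  have "(\<Sum>\<omega>\<in>configs N. exp (- hamiltonian S \<alpha> \<beta> N (\<omega> :: nat \<Rightarrow> 'q))) > 0"
    by (intro sum_pos) auto
  then show "emeasure (gibbs_measure S \<alpha> \<beta> N :: (nat \<Rightarrow> 'q) measure) (space (gibbs_measure S \<alpha> \<beta> N)) = 1"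
    unfolding gibbs_measure_def
    by (simp add: space_point_measure emeasure_point_measure_finite sum_ennreal less_imp_le sum_divide_distrib[symmetric])
qed

lemma measure_gibbs_measure:
  fixes S :: "nat \<Rightarrow> 's::finite \<Rightarrow> nat set" and B :: "(real^'q::finite^'s) set"
  shows "measure (gibbs_measure S \<alpha> \<beta> N) {\<omega> \<in> space (gibbs_measure S \<alpha> \<beta> N). order_parameter S N \<omega> \<in> B}
    = boltzmann_sum S \<alpha> \<beta> N B / boltzmann_sum S \<alpha> \<beta> N (UNIV :: (real^'q^'s) set)"
  unfolding gibbs_measure_eq
  by (subst measure_point_measure_finite_if)
     (auto simp: space_point_measure boltzmann_sum_def sum_divide_distrib intro!: divide_nonneg_nonneg sum_nonneg)

text \<open>The case \<open>p = 0\<close> arises when \<open>M_N\<close> has no value in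
  \<open>B\<close>; the quotient is then minus infinity, below every real bound.\<close>

lemma eln_le:
  assumes "0 \<le> p" "p \<le> exp (real N * d)" "N > 0"
  shows "eln p / ereal (real N) \<le> ereal d"
proof (cases "p = 0")
  case False
  then have "ln p \<le> ln (exp (real N * d))" using assms by (subst ln_le_cancel_iff) auto
  then have "ln p \<le> real N * d" by simp
  then show ?thesis using False assms by (simp add: eln_def field_simps)
qed (use assms in \<open>simp add: eln_def\<close>)

lemma eln_ge:
  assumes "exp (real N * d) \<le> p" "N > 0"
  shows "ereal d \<le> eln p / ereal (real N)"
proof -
  have "p > 0" using assms(1) exp_gt_zero order_less_le_trans by blast
  then have "real N * d \<le> ln p" using assms(1) by (simp add: ln_ge_iff)
  then show ?thesis using \<open>p > 0\<close> assms by (simp add: eln_def field_simps)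
qed

theorem theorem3p2:
  fixes S :: "nat \<Rightarrow> 's::finite \<Rightarrow> nat set"
    and \<gamma> :: "'s \<Rightarrow> real"
    and \<alpha> \<beta> :: real
  assumes "block_partition S"
    and "limiting_proportions S \<gamma>"
    and "CARD('q::finite) \<ge> 3"
    and "0 < \<alpha>" and "\<alpha> < \<beta>"
  shows "LDP (gibbs_measure S \<alpha> \<beta> :: nat \<Rightarrow> (nat \<Rightarrow> 'q) measure)
             (order_parameter S :: nat \<Rightarrow> (nat \<Rightarrow> 'q) \<Rightarrow> real^'q^'s)
             real
             (potts_rate \<gamma> \<alpha> \<beta>)
         \<and> (\<forall>\<nu> \<in> (prob_rows :: (real^'q^'s) set).
              potts_rate \<gamma> \<alpha> \<beta> \<nu> =
                - ereal (explicit_functional \<gamma> \<alpha> \<beta> \<nu>)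
                + (SUP \<mu>\<in>(prob_rows :: (real^'q^'s) set). ereal (explicit_functional \<gamma> \<alpha> \<beta> \<mu>)))"
proof (intro conjI ballI)
  show "potts_rate \<gamma> \<alpha> \<beta> \<nu> = - ereal (explicit_functional \<gamma> \<alpha> \<beta> \<nu>)
     + (SUP \<mu>\<in>(prob_rows :: (real^'q^'s) set). ereal (explicit_functional \<gamma> \<alpha> \<beta> \<mu>))"
    if "\<nu> \<in> prob_rows" for \<nu> :: "real^'q^'s"
    using that by (rule potts_rate_explicit)
  note S = assms(1) and \<gamma> = assms(2)
  let ?P = "gibbs_measure S \<alpha> \<beta> :: nat \<Rightarrow> (nat \<Rightarrow> 'q) measure"
  let ?M = "order_parameter S :: nat \<Rightarrow> (nat \<Rightarrow> 'q) \<Rightarrow> real^'q^'s"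
  let ?f = "free_functional \<gamma> \<alpha> \<beta> :: real^'q^'s \<Rightarrow> real"
  let ?J = "potts_rate \<gamma> \<alpha> \<beta> :: real^'q^'s \<Rightarrow> ereal"
  let ?Z = "\<lambda>N. boltzmann_sum S \<alpha> \<beta> N (UNIV :: (real^'q^'s) set)"
  obtain m where m: "m \<in> (prob_rows :: (real^'q^'s) set)" "\<And>\<mu>. \<mu> \<in> prob_rows \<Longrightarrow> ?f \<mu> \<le> ?f m"
    "\<And>\<nu>. ?J \<nu> = (if \<nu> \<in> prob_rows then ereal (?f m - ?f \<nu>) else \<infinity>)"
    using potts_rate_eq by blast
  have "let r = (\<lambda>n. eln (measure (?P n) {w \<in> space (?P n). ?M n w \<in> B}) / ereal (real n)) in
          - (INF x\<in>interior B. ?J x) \<le> liminf r \<and> liminf r \<le> limsup r \<and> limsup r \<le> - (INF x\<in>closure B. ?J x)"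
    for B :: "(real^'q^'s) set"
  proof -
    define r where "r = (\<lambda>N. eln (boltzmann_sum S \<alpha> \<beta> N B / ?Z N) / ereal (real N))"
    have "- liminf r \<le> (INF x\<in>interior B. ?J x)"
    proof (rule INF_greatest)
      fix x assume x: "x \<in> interior B"
      have "- ?J x \<le> liminf r"
      \<comment> \<open>Testing with \<open>y\<close> strictly below \<open>- ?J x\<close> leaves
        room for error terms; a real \<open>y\<close> of this kind forces \<open>x\<close> into
        \<open>prob_rows\<close>.\<close>
      proof (rule dense_le)
        fix y assume y: "y < - ?J x"
        show "y \<le> liminf r"
        proof (cases y)
          case (real d)
          have xP: "x \<in> prob_rows" using y m(3)[of x] by (cases "x \<in> prob_rows") auto
          then have d: "d < ?f x - ?f m" using y real m(3)[of x] by simp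
          \<comment> \<open>Half the gap, since the numerator and the partition function each lose
            one \<open>e\<close>.\<close>
          define e where "e = (?f x - ?f m - d) / 2"
          have e: "e > 0" using d by (simp add: e_def)
          have "\<forall>\<^sub>F N in sequentially. ?Z N \<le> exp (real N * (?f m + e))"
            by (rule boltzmann_sum_upper[OF S \<gamma> m(2) e])
          from this boltzmann_sum_lower[OF S \<gamma> xP x e, of \<alpha> \<beta>] eventually_gt_at_top[of 0]
          have "\<forall>\<^sub>F N in sequentially. ereal d \<le> r N"
          proof eventually_elim
            case (elim N)
            have "exp (real N * d) = exp (real N * (?f x - e)) / exp (real N * (?f m + e))"
              by (simp add: exp_diff[symmetric] e_def algebra_simps)
            also have "\<dots> \<le> boltzmann_sum S \<alpha> \<beta> N B / ?Z N"
              using elim boltzmann_sum_UNIV_pos by (intro frac_le) (auto intro: order_trans[OF less_imp_le[OF exp_gt_zero]])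
            finally show ?case unfolding r_def using elim by (intro eln_ge)
          qed
          then show ?thesis unfolding real by (rule Liminf_bounded)
        qed (use y in auto)
      qed
      then show "- liminf r \<le> ?J x" by (simp add: ereal_uminus_le_reorder)
    qed
    moreover have "limsup r \<le> - (INF x\<in>closure B. ?J x)"
    proof (rule dense_ge)
      fix y assume y: "- (INF x\<in>closure B. ?J x) < y"
      show "limsup r \<le> y"
      proof (cases y)
        case (real d)
        \<comment> \<open>The infimum may be infinite, so a real number \<open>c\<close> strictly
          between its negative and \<open>d\<close> takes its place in the estimates.\<close>
        obtain c where c: "- (INF x\<in>closure B. ?J x) < ereal c" "ereal c < ereal d"
          using ereal_dense2[OF y[unfolded real]] by blast
        define e where "e = (d - c) / 2"
        have e: "e > 0" using c by (simp add: e_def)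
        have fB: "?f \<mu> \<le> ?f m + c" if "\<mu> \<in> B" "\<mu> \<in> prob_rows" for \<mu>
        proof -
          have "(INF x\<in>closure B. ?J x) \<le> ?J \<mu>" using that closure_subset by (intro INF_lower) blast
          moreover have "ereal (- c) < (INF x\<in>closure B. ?J x)"
            using c(1) by (simp add: ereal_uminus_less_reorder)
          ultimately have "ereal (- c) < ?J \<mu>" by (rule less_le_trans[rotated])
          then show ?thesis using that m(3)[of \<mu>] by simp
        qed
        \<comment> \<open>The partition function is bounded below by the neighbourhood of the
          maximiser \<open>m\<close>.\<close>
        have "\<forall>\<^sub>F N in sequentially. exp (real N * (?f m - e)) \<le> ?Z N"
          by (rule boltzmann_sum_lower[OF S \<gamma> m(1) _ e]) simp
        moreover have "\<forall>\<^sub>F N in sequentially. boltzmann_sum S \<alpha> \<beta> N B \<le> exp (real N * (?f m + c + e))"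
          by (rule boltzmann_sum_upper[OF S \<gamma> fB e])
        ultimately have "\<forall>\<^sub>F N in sequentially. r N \<le> ereal d"
          using eventually_gt_at_top[of 0]
        proof eventually_elim
          case (elim N)
          have "0 \<le> boltzmann_sum S \<alpha> \<beta> N B" by (auto simp: boltzmann_sum_def intro: sum_nonneg)
          moreover have "boltzmann_sum S \<alpha> \<beta> N B / ?Z N \<le> exp (real N * (?f m + c + e)) / exp (real N * (?f m - e))"
            using elim by (intro frac_le) auto
          moreover have "\<dots> = exp (real N * d)"
            by (simp add: exp_diff[symmetric] e_def algebra_simps)
          ultimately show ?case unfolding r_def using elim boltzmann_sum_UNIV_pos[of S \<alpha> \<beta> N, where 'q='q]
            by (intro eln_le) (auto intro: divide_nonneg_pos)
        qed
        then show ?thesis unfolding real by (rule Limsup_bounded)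
      qed (use y in auto)
    qed
    moreover have "liminf r \<le> limsup r" by (intro Liminf_le_Limsup) simp
    ultimately show ?thesis unfolding Let_def measure_gibbs_measure r_def[symmetric]
      by (simp add: ereal_uminus_le_reorder)
  qed
  \<comment> \<open>Measurability of \<open>?M\<close> is automatic, since every subset is
    measurable for a point measure.\<close>
  then show "LDP ?P ?M real ?J"
    unfolding LDP_def using prob_space_gibbs_measure[of S \<alpha> \<beta>] rate_function_potts_rate[of \<gamma> \<alpha> \<beta>]
    by (auto simp: gibbs_measure_def)
qed

end
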